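(* Let $Q_n$ be the $k$-th order spline sieve MLE, HAL-MLE or relax HAL-MLE of $Q_0=\arg\min_QP_0L(Q)$, with $\mathcal R_{0,n}=\mathcal R_n$ (allowed to be data dependent), so that $(Q_n-Q_{0,n})(x)=P_nD_{Q_{0,n},x}+R_n(x)$ with $D_{Q_{0,n},x}=\sum_{j\in\mathcal R_{0,n}}S_{Q_{0,n}}(\phi_j^* )\phi_j^*(x)$ and $R_n(x)=\sum_{j\in\mathcal R_{0,n}}R_n(\phi_j^* )\phi_j^*(x)$, $R_n(\phi_j^* )=-r_n(\phi_j^* )+E_n(\phi_j^* )+(R_{1,n}+R_{3,n})(\phi_j^* )$. Assume $\Phi$ is a real-valued functional differentiable at $Q_{0,n}$ so that $$\Phi(Q_n)-\Phi(Q_{0,n})=P_nd\Phi_{Q_{0,n}}(D_{Q_{0,n},\cdot})+d\Phi_{Q_{0,n}}(R_n)+R_\Phi(Q_n,Q_{0,n}).$$ Let $D_{\Phi,Q_{0,n}}=d\Phi_{Q_{0,n}}(D_{Q_{0,n},\cdot})$ and let $\tilde D_{\Phi,Q_{0,n}}\in D^{(k)}(\mathcal R_{0,n})$ be the canonical gradient: $d\Phi_{Q_{0,n}}(h)=\langle\tilde D_{\Phi,Q_{0,n}},h\rangle_{J_{0,n}}$ for $h\in D^{(k)}(\mathcal R_{0,n})$. Then $D_{\Phi,Q_{0,n}}=S_{Q_{0,n}}(\tilde D_{\Phi,Q_{0,n}})$. Assume further: $d\Phi_{Q_{0,n}}(R_n)=o_P(n^{-1/2})$; $R_\Phi(Q_n,Q_{0,n})=o_P(n^{-1/2})$;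 for a limit $D_{\Phi,Q_0}$, $P_0\{D_{\Phi,Q_{0,n}}-D_{\Phi,Q_0}\}^2\to_p0$; and $D_{\Phi,Q_{0,n}}$ is an element of a fixed $P_0$-Donsker class with probability tending to 1. Then $\Phi(Q_n)-\Phi(Q_{0,n})=P_nD_{\Phi,Q_0}+o_P(n^{-1/2})$. If also $\Phi(Q_{0,n})-\Phi(Q_0)=o_P(n^{-1/2})$, then $\Phi(Q_n)$ is asymptotically linear at $P_0$ as an estimator of $\Phi(Q_0)$ with influence curve $D_{\Phi,Q_0}$.
   Context: Splines. For $s\subset\{1,\dots,d\}$, $x(s)=(x(j))_{j\in s}$, $s/s'$ is set difference. $\mathcal S^{k+1}(d)$: all $\bar s(k+1)=(s_1,\dots,s_{k+1})$ with $s_{k+1}\subset\cdots\subset s_1\subset\{1,\dots,d\}$ (empty sets allowed). $\phi^j_u(x)=\prod_{l\in s}\frac{(x(l)-u(l))^j}{j!}I(x(l)\ge u(l))$ for $u,x\in[0,1]^s$. $\bar\phi_{\bar s(k+1)}(x)=\prod_{j=1}^{k}\phi^j_0(x(s_j/s_{j+1}))$ if $s_{k+1}\ne\emptyset$, and $\prod_{j=1}^{m}\phi^j_0(x(s_j/s_{j+1}))$ if $s_{k+1}=\emptyset$, $m\in\{0,\dots,k\}$ smallest with $s_{m+1}=\emptyset$. Basis functions indexed by $j$: $\phi_{(\bar s(k+1),u)}=\bar\phi_{\bar s(k+1)}(x)\phi^k_u(x(s_{k+1}))$ ($s_{k+1}\neq\emptyset$, knot $u\in(0(s_{k+1}),1(s_{k+1})]$)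 and $\phi_{\bar s(k+1)}=\bar\phi_{\bar s(k+1)}$ ($s_{k+1}=\emptyset$). For a finite index set $\mathcal R$, $D^{(k)}(\mathcal R)=\{\sum_{j\in\mathcal R}\beta(j)\phi_j\}$, and $D^{(k)}_C(\mathcal R)$ is the subset with $\|\beta\|_1\le C$. Data and estimators. $O_1,\dots,O_n$ i.i.d. $P_0$; $P_n$ empirical measure; $Pf=\int f\,dP$ (data-dependent index sets held fixed under $P_0$); $L(Q)(O)$ a loss. The sieve MLE minimizes $P_nL$ over $D^{(k)}(\mathcal R)$ for a data-adaptively selected member $\mathcal R$ of a prespecified family of finite index sets; the HAL-MLE minimizes $P_nL$ over $D^{(k)}_{C_n}(\mathcal R_{\max,n})$ for a large finite index set and data-adaptive $C_n$; the relax HAL-MLE minimizes $P_nL$ without penalty over $D^{(k)}$ of the indices with non-zero coefficient in the HAL-MLE. $\mathcal R_n$ is the set of indices with non-zero coefficient in $Q_n$. Oracle, scores and remainders. $Q_{0,n}=\arg\min_{Q\in D^{(k)}(\mathcal R_{0,n})}P_0L(Q)$. $S_Q(\phi)=-\frac{d}{d\delta}L(Q+\delta\phi)|_{\delta=0}$, $dS_Q(\phi)(h)=\frac d{d\delta}S_{Q+\delta h}(\phi)|_{\delta=0}$. $\langle\phi,g\rangle_{J_{0,n}}=-P_0dS_{Q_{0,n}}(\phi)(g)$ on $D^{(k)}(\mathcal R_{0,n})$, or, for log-likelihood behaving losses, $P_0S_{Q_{0,n}}(\phi)S_{Q_{0,n}}(g)$; $\{\phi_j^*\}_{j\in\mathcal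 R_{0,n}}$ is an orthonormal basis of $D^{(k)}(\mathcal R_{0,n})$ for this inner product. $r_n(\phi)=P_nS_{Q_n}(\phi)$; $E_n(\phi)=(P_n-P_0)(S_{Q_n}(\phi)-S_{Q_{0,n}}(\phi))$; $R_{1,n}(\phi)=P_0\{S_{Q_n}(\phi)-S_{Q_{0,n}}(\phi)\}-P_0dS_{Q_{0,n}}(\phi)(Q_n-Q_{0,n})$; $-R_{3,n}(\phi)=-P_0dS_{Q_{0,n}}(\phi)(Q_n-Q_{0,n})-\langle\phi,Q_n-Q_{0,n}\rangle_{J_{0,n}}$. $d\Phi_{Q_{0,n}}$ is the (linear) directional derivative of $\Phi$ at $Q_{0,n}$ on $D^{(k)}(\mathcal R_{0,n})$; $d\Phi_{Q_{0,n}}(D_{Q_{0,n},\cdot})$ applies it to $x\mapsto D_{Q_{0,n},x}(o)$ for each $o$. Asymptotic linearity with influence curve $D$ means $\Phi(Q_n)-\Phi(Q_0)=P_nD+o_P(n^{-1/2})$.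
   Formalization: Adds the regularity that scores at Q_{0,n} are linear in the direction and that P_0L may be differentiated under the integral at Q_{0,n} along D^(k)(R_{0,n}), giving P_0 S_{Q_{0,n}}(φ)=0; without the latter the asymptotic claim can fail. *)

theory Defs
  imports "HOL-Probability.Probability"
begin

section \<open>Splines\<close>

text \<open>
  The coordinates \<open>{1..d}\<close> are a finite type \<open>'d\<close>. A function on the unit cube is represented by a
  function on \<open>real^'d\<close> that vanishes outside the cube, so that equality and linear independence of
  splines are those of functions on the cube. A basis index is a pair \<open>(s, u)\<close>: the list
  \<open>s = [s\<^sub>1, ..., s\<^sub>k\<^sub>+\<^sub>1]\<close>, so that \<open>s\<^sub>j\<close> is \<open>s ! (j - 1)\<close>, and a knot \<open>u\<close> of which only the coordinates in
  \<open>s\<^sub>k\<^sub>+\<^sub>1\<close> matter; the others are set to 0, so each index has one representation (in particular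
  \<open>u = 0\<close> when \<open>s\<^sub>k\<^sub>+\<^sub>1\<close> is empty and there is no knot).
\<close>

type_synonym 'd spline_index = "'d set list \<times> (real^'d)"

definition spline_indices :: "nat \<Rightarrow> 'd::finite spline_index set" where
  "spline_indices k = {(s, u). length s = k + 1 \<and> (\<forall>j<k. s ! (j + 1) \<subseteq> s ! j) \<and>
     (\<forall>l. if l \<in> s ! k then 0 < u $ l \<and> u $ l \<le> 1 else u $ l = 0)}"

definition spline_phi :: "'d::finite set \<Rightarrow> nat \<Rightarrow> real^'d \<Rightarrow> real^'d \<Rightarrow> real" where
  "spline_phi s j u x = (\<Prod>l\<in>s. (x $ l - u $ l) ^ j / fact j * of_bool (x $ l \<ge> u $ l))"

definition spline_phi_bar :: "nat \<Rightarrow> 'd::finite set list \<Rightarrow> real^'d \<Rightarrow> real" where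
  "spline_phi_bar k s x =
     (\<Prod>j = 1..(if s ! k \<noteq> {} then k else (LEAST m. s ! m = {})).
        spline_phi (s ! (j - 1) - s ! j) j 0 x)"

definition spline_basis :: "nat \<Rightarrow> 'd::finite spline_index \<Rightarrow> real^'d \<Rightarrow> real" where
  "spline_basis k i x = (case i of (s, u) \<Rightarrow>
     if x \<in> cbox 0 1
     then spline_phi_bar k s x * (if s ! k \<noteq> {} then spline_phi (s ! k) k u x else 1)
     else 0)"

definition spline ::
    "nat \<Rightarrow> 'd::finite spline_index set \<Rightarrow> ('d spline_index \<Rightarrow> real) \<Rightarrow> real^'d \<Rightarrow> real" where
  "spline k R \<beta> x = (\<Sum>j\<in>R. \<beta> j * spline_basis k j x)"

definition spline_space :: "nat \<Rightarrow> 'd::finite spline_index set \<Rightarrow> (real^'d \<Rightarrow> real) set" where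
  "spline_space k R = range (spline k R)"

definition spline_ball ::
    "nat \<Rightarrow> 'd::finite spline_index set \<Rightarrow> real \<Rightarrow> (real^'d \<Rightarrow> real) set" where
  "spline_ball k R C = spline k R ` {\<beta>. (\<Sum>j\<in>R. \<bar>\<beta> j\<bar>) \<le> C}"


section \<open>Estimators\<close>

text \<open>
  The empirical mean \<open>P\<^sub>n f\<close> of the first \<open>n\<close> terms of the sequence \<open>y\<close>.
\<close>

definition emp :: "nat \<Rightarrow> (nat \<Rightarrow> 'o) \<Rightarrow> ('o \<Rightarrow> real) \<Rightarrow> real" where
  "emp n y f = (\<Sum>i<n. f (y i)) / real n"

text \<open>
  The estimators are described by their coefficient vectors \<open>\<beta>\<close>; \<open>risk\<close> is the empirical risk
  \<open>Q \<mapsto> P\<^sub>n L(Q)\<close>.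
\<close>

definition nonzero :: "('j \<Rightarrow> real) \<Rightarrow> 'j set" where
  "nonzero \<beta> = {j. \<beta> j \<noteq> 0}"

definition sieve_MLE :: "nat \<Rightarrow> 'd::finite spline_index set set \<Rightarrow>
    ((real^'d \<Rightarrow> real) \<Rightarrow> real) \<Rightarrow> ('d spline_index \<Rightarrow> real) \<Rightarrow> bool" where
  "sieve_MLE k \<R> risk \<beta> \<longleftrightarrow> (\<exists>R\<in>\<R>. nonzero \<beta> \<subseteq> R \<and>
     is_arg_min risk (\<lambda>Q. Q \<in> spline_space k R) (spline k R \<beta>))"

definition HAL_MLE :: "nat \<Rightarrow> 'd::finite spline_index set \<Rightarrow> real \<Rightarrow>
    ((real^'d \<Rightarrow> real) \<Rightarrow> real) \<Rightarrow> ('d spline_index \<Rightarrow> real) \<Rightarrow> bool" where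
  "HAL_MLE k Rmax C risk \<beta> \<longleftrightarrow> nonzero \<beta> \<subseteq> Rmax \<and> (\<Sum>j\<in>Rmax. \<bar>\<beta> j\<bar>) \<le> C \<and>
     is_arg_min risk (\<lambda>Q. Q \<in> spline_ball k Rmax C) (spline k Rmax \<beta>)"

definition relax_HAL_MLE :: "nat \<Rightarrow> 'd::finite spline_index set \<Rightarrow> real \<Rightarrow>
    ((real^'d \<Rightarrow> real) \<Rightarrow> real) \<Rightarrow> ('d spline_index \<Rightarrow> real) \<Rightarrow> bool" where
  "relax_HAL_MLE k Rmax C risk \<beta> \<longleftrightarrow> (\<exists>\<beta>'. HAL_MLE k Rmax C risk \<beta>' \<and> nonzero \<beta> \<subseteq> nonzero \<beta>' \<and>
     is_arg_min risk (\<lambda>Q. Q \<in> spline_space k (nonzero \<beta>')) (spline k (nonzero \<beta>') \<beta>))"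

text \<open>
  Minimizers of \<open>Q \<mapsto> P\<^sub>0 L(Q)\<close> over a set of functions. Candidates with a non-integrable loss are
  excluded, because the Bochner integral would assign them risk 0.
\<close>

definition risk_minimizer ::
    "'o measure \<Rightarrow> ('q \<Rightarrow> 'o \<Rightarrow> real) \<Rightarrow> 'q set \<Rightarrow> 'q \<Rightarrow> bool" where
  "risk_minimizer P0 L V Q \<longleftrightarrow>
     is_arg_min (\<lambda>Q. \<integral>z. L Q z \<partial>P0) (\<lambda>Q. Q \<in> V \<and> integrable P0 (L Q)) Q"


section \<open>Directional derivatives, scores and remainders\<close>

definition dirderiv :: "(('x \<Rightarrow> real) \<Rightarrow> real) \<Rightarrow> ('x \<Rightarrow> real) \<Rightarrow> ('x \<Rightarrow> real) \<Rightarrow> real" where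
  "dirderiv F Q h = deriv (\<lambda>\<delta>. F (\<lambda>x. Q x + \<delta> * h x)) 0"

definition linear_along :: "('x \<Rightarrow> real) set \<Rightarrow> (('x \<Rightarrow> real) \<Rightarrow> real) \<Rightarrow> bool" where
  "linear_along V T \<longleftrightarrow> (\<forall>f\<in>V. \<forall>g\<in>V. \<forall>a b. T (\<lambda>x. a * f x + b * g x) = a * T f + b * T g)"

definition differentiable_along ::
    "('x \<Rightarrow> real) set \<Rightarrow> (('x \<Rightarrow> real) \<Rightarrow> real) \<Rightarrow> ('x \<Rightarrow> real) \<Rightarrow> bool" where
  "differentiable_along V F Q \<longleftrightarrow>
     (\<forall>h\<in>V. (\<lambda>\<delta>. F (\<lambda>x. Q x + \<delta> * h x)) differentiable (at 0)) \<and> linear_along V (dirderiv F Q)"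

definition score ::
    "(('x \<Rightarrow> real) \<Rightarrow> 'o \<Rightarrow> real) \<Rightarrow> ('x \<Rightarrow> real) \<Rightarrow> ('x \<Rightarrow> real) \<Rightarrow> 'o \<Rightarrow> real" where
  "score L Q \<phi> z = - dirderiv (\<lambda>q. L q z) Q \<phi>"

definition dscore ::
    "(('x \<Rightarrow> real) \<Rightarrow> 'o \<Rightarrow> real) \<Rightarrow> ('x \<Rightarrow> real) \<Rightarrow> ('x \<Rightarrow> real) \<Rightarrow> ('x \<Rightarrow> real) \<Rightarrow> 'o \<Rightarrow> real" where
  "dscore L Q \<phi> h z = dirderiv (\<lambda>q. score L q \<phi> z) Q h"

text \<open>
  The risk is differentiable in direction \<open>\<phi>\<close>, with the derivative taken under the integral sign.
  This is what makes \<open>P\<^sub>0 S\<^sub>Q(\<phi>) = 0\<close> the first order condition of a risk minimizer.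
\<close>

definition risk_differentiable ::
    "'o measure \<Rightarrow> (('x \<Rightarrow> real) \<Rightarrow> 'o \<Rightarrow> real) \<Rightarrow> ('x \<Rightarrow> real) \<Rightarrow> ('x \<Rightarrow> real) \<Rightarrow> bool" where
  "risk_differentiable P0 L Q \<phi> \<longleftrightarrow>
     (\<forall>\<^sub>F \<delta> in nhds 0. integrable P0 (L (\<lambda>x. Q x + \<delta> * \<phi> x))) \<and>
     integrable P0 (score L Q \<phi>) \<and>
     ((\<lambda>\<delta>. \<integral>z. L (\<lambda>x. Q x + \<delta> * \<phi> x) z \<partial>P0) has_real_derivative
        - (\<integral>z. score L Q \<phi> z \<partial>P0)) (at 0)"

text \<open>
  The two choices of the inner product \<open>\<langle>\<phi>, g\<rangle>\<^sub>J\<close>: \<open>-P\<^sub>0 dS\<^sub>Q(\<phi>)(g)\<close> and \<open>P\<^sub>0 S\<^sub>Q(\<phi>) S\<^sub>Q(g)\<close>.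
\<close>

datatype information = Hessian | Score_Covariance

definition J_inner :: "information \<Rightarrow> 'o measure \<Rightarrow> (('x \<Rightarrow> real) \<Rightarrow> 'o \<Rightarrow> real) \<Rightarrow> ('x \<Rightarrow> real) \<Rightarrow>
    ('x \<Rightarrow> real) \<Rightarrow> ('x \<Rightarrow> real) \<Rightarrow> real" where
  "J_inner J P0 L Q \<phi> g = (case J of
       Hessian \<Rightarrow> - (\<integral>z. dscore L Q \<phi> g z \<partial>P0)
     | Score_Covariance \<Rightarrow> \<integral>z. score L Q \<phi> z * score L Q g z \<partial>P0)"

definition inner_product_along ::
    "('x \<Rightarrow> real) set \<Rightarrow> (('x \<Rightarrow> real) \<Rightarrow> ('x \<Rightarrow> real) \<Rightarrow> real) \<Rightarrow> bool" where
  "inner_product_along V ip \<longleftrightarrow>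
     (\<forall>f\<in>V. \<forall>g\<in>V. ip f g = ip g f) \<and>
     (\<forall>g\<in>V. linear_along V (\<lambda>f. ip f g)) \<and>
     (\<forall>f\<in>V. f \<noteq> (\<lambda>x. 0) \<longrightarrow> ip f f > 0)"

definition orthonormal_basis_along :: "('x \<Rightarrow> real) set \<Rightarrow>
    (('x \<Rightarrow> real) \<Rightarrow> ('x \<Rightarrow> real) \<Rightarrow> real) \<Rightarrow> 'j set \<Rightarrow> ('j \<Rightarrow> 'x \<Rightarrow> real) \<Rightarrow> bool" where
  "orthonormal_basis_along V ip R \<phi> \<longleftrightarrow>
     (\<forall>j\<in>R. \<phi> j \<in> V) \<and>
     (\<forall>i\<in>R. \<forall>j\<in>R. ip (\<phi> i) (\<phi> j) = of_bool (i = j)) \<and>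
     (\<forall>f\<in>V. \<exists>c. f = (\<lambda>x. \<Sum>j\<in>R. c j * \<phi> j x))"

definition canonical_gradient :: "('x \<Rightarrow> real) set \<Rightarrow>
    (('x \<Rightarrow> real) \<Rightarrow> ('x \<Rightarrow> real) \<Rightarrow> real) \<Rightarrow> (('x \<Rightarrow> real) \<Rightarrow> real) \<Rightarrow> ('x \<Rightarrow> real) \<Rightarrow> bool" where
  "canonical_gradient V ip T D \<longleftrightarrow> D \<in> V \<and> (\<forall>h\<in>V. T h = ip D h)"

text \<open>
  In the following \<open>P\<close> is the functional \<open>f \<mapsto> P\<^sub>n f\<close>, \<open>Q\<close> stands for \<open>Q\<^sub>n\<close> and \<open>Q'\<close> for \<open>Q\<^sub>0\<^sub>,\<^sub>n\<close>.
\<close>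

definition score_residual :: "(('o \<Rightarrow> real) \<Rightarrow> real) \<Rightarrow> (('x \<Rightarrow> real) \<Rightarrow> 'o \<Rightarrow> real) \<Rightarrow>
    ('x \<Rightarrow> real) \<Rightarrow> ('x \<Rightarrow> real) \<Rightarrow> real" where
  "score_residual P L Q \<phi> = P (score L Q \<phi>)"

definition E_rem :: "(('o \<Rightarrow> real) \<Rightarrow> real) \<Rightarrow> 'o measure \<Rightarrow> (('x \<Rightarrow> real) \<Rightarrow> 'o \<Rightarrow> real) \<Rightarrow>
    ('x \<Rightarrow> real) \<Rightarrow> ('x \<Rightarrow> real) \<Rightarrow> ('x \<Rightarrow> real) \<Rightarrow> real" where
  "E_rem P P0 L Q Q' \<phi> = P (\<lambda>z. score L Q \<phi> z - score L Q' \<phi> z)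
     - (\<integral>z. score L Q \<phi> z - score L Q' \<phi> z \<partial>P0)"

definition R1_rem :: "'o measure \<Rightarrow> (('x \<Rightarrow> real) \<Rightarrow> 'o \<Rightarrow> real) \<Rightarrow>
    ('x \<Rightarrow> real) \<Rightarrow> ('x \<Rightarrow> real) \<Rightarrow> ('x \<Rightarrow> real) \<Rightarrow> real" where
  "R1_rem P0 L Q Q' \<phi> = (\<integral>z. score L Q \<phi> z - score L Q' \<phi> z \<partial>P0)
     - (\<integral>z. dscore L Q' \<phi> (\<lambda>x. Q x - Q' x) z \<partial>P0)"

definition R3_rem :: "information \<Rightarrow> 'o measure \<Rightarrow> (('x \<Rightarrow> real) \<Rightarrow> 'o \<Rightarrow> real) \<Rightarrow>
    ('x \<Rightarrow> real) \<Rightarrow> ('x \<Rightarrow> real) \<Rightarrow> ('x \<Rightarrow> real) \<Rightarrow> real" where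
  "R3_rem J P0 L Q Q' \<phi> = - (- (\<integral>z. dscore L Q' \<phi> (\<lambda>x. Q x - Q' x) z \<partial>P0)
     - J_inner J P0 L Q' \<phi> (\<lambda>x. Q x - Q' x))"

definition coef_rem :: "information \<Rightarrow> (('o \<Rightarrow> real) \<Rightarrow> real) \<Rightarrow> 'o measure \<Rightarrow>
    (('x \<Rightarrow> real) \<Rightarrow> 'o \<Rightarrow> real) \<Rightarrow> ('x \<Rightarrow> real) \<Rightarrow> ('x \<Rightarrow> real) \<Rightarrow> ('x \<Rightarrow> real) \<Rightarrow> real" where
  "coef_rem J P P0 L Q Q' \<phi> = - score_residual P L Q \<phi> + E_rem P P0 L Q Q' \<phi>
     + (R1_rem P0 L Q Q' \<phi> + R3_rem J P0 L Q Q' \<phi>)"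

definition D_expansion :: "(('x \<Rightarrow> real) \<Rightarrow> 'o \<Rightarrow> real) \<Rightarrow> ('x \<Rightarrow> real) \<Rightarrow> 'j set \<Rightarrow>
    ('j \<Rightarrow> 'x \<Rightarrow> real) \<Rightarrow> 'x \<Rightarrow> 'o \<Rightarrow> real" where
  "D_expansion L Q' R \<phi> x z = (\<Sum>j\<in>R. score L Q' (\<phi> j) z * \<phi> j x)"

definition R_expansion :: "information \<Rightarrow> (('o \<Rightarrow> real) \<Rightarrow> real) \<Rightarrow> 'o measure \<Rightarrow>
    (('x \<Rightarrow> real) \<Rightarrow> 'o \<Rightarrow> real) \<Rightarrow> ('x \<Rightarrow> real) \<Rightarrow> ('x \<Rightarrow> real) \<Rightarrow> 'j set \<Rightarrow>
    ('j \<Rightarrow> 'x \<Rightarrow> real) \<Rightarrow> 'x \<Rightarrow> real" where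
  "R_expansion J P P0 L Q Q' R \<phi> x = (\<Sum>j\<in>R. coef_rem J P P0 L Q Q' (\<phi> j) * \<phi> j x)"

definition D_functional :: "(('x \<Rightarrow> real) \<Rightarrow> real) \<Rightarrow> (('x \<Rightarrow> real) \<Rightarrow> 'o \<Rightarrow> real) \<Rightarrow>
    ('x \<Rightarrow> real) \<Rightarrow> 'j set \<Rightarrow> ('j \<Rightarrow> 'x \<Rightarrow> real) \<Rightarrow> 'o \<Rightarrow> real" where
  "D_functional \<Phi> L Q' R \<phi> z = dirderiv \<Phi> Q' (\<lambda>x. D_expansion L Q' R \<phi> x z)"

definition functional_rem ::
    "(('x \<Rightarrow> real) \<Rightarrow> real) \<Rightarrow> ('x \<Rightarrow> real) \<Rightarrow> ('x \<Rightarrow> real) \<Rightarrow> real" where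
  "functional_rem \<Phi> Q Q' = \<Phi> Q - \<Phi> Q' - dirderiv \<Phi> Q' (\<lambda>x. Q x - Q' x)"


section \<open>Stochastic order symbols and Donsker classes\<close>

text \<open>
  Estimators and remainders need not be measurable maps on the sample space, so probabilities are
  outer probabilities, as usual in empirical process theory; on measurable events these are the
  ordinary probabilities.
\<close>

definition prob_tends_to_0 :: "'w measure \<Rightarrow> (nat \<Rightarrow> 'w \<Rightarrow> bool) \<Rightarrow> bool" where
  "prob_tends_to_0 M E \<longleftrightarrow> (\<lambda>n. outer_measure_of M {\<omega>\<in>space M. E n \<omega>}) \<longlonglongrightarrow> 0"

definition with_prob_tending_to_1 :: "'w measure \<Rightarrow> (nat \<Rightarrow> 'w \<Rightarrow> bool) \<Rightarrow> bool" where
  "with_prob_tending_to_1 M E \<longleftrightarrow> prob_tends_to_0 M (\<lambda>n \<omega>. \<not> E n \<omega>)"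

definition small_o_P :: "'w measure \<Rightarrow> (nat \<Rightarrow> real) \<Rightarrow> (nat \<Rightarrow> 'w \<Rightarrow> real) \<Rightarrow> bool" where
  "small_o_P M a X \<longleftrightarrow> (\<forall>\<epsilon>>0. prob_tends_to_0 M (\<lambda>n \<omega>. \<bar>X n \<omega>\<bar> > \<epsilon> * a n))"

definition converges_to_0_in_prob :: "'w measure \<Rightarrow> (nat \<Rightarrow> 'w \<Rightarrow> ennreal) \<Rightarrow> bool" where
  "converges_to_0_in_prob M X \<longleftrightarrow> (\<forall>\<epsilon>::real>0. prob_tends_to_0 M (\<lambda>n \<omega>. X n \<omega> > ennreal \<epsilon>))"

definition asymptotically_linear :: "'w measure \<Rightarrow> (nat \<Rightarrow> 'w \<Rightarrow> 'o) \<Rightarrow>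
    (nat \<Rightarrow> 'w \<Rightarrow> real) \<Rightarrow> real \<Rightarrow> ('o \<Rightarrow> real) \<Rightarrow> bool" where
  "asymptotically_linear M X est target D \<longleftrightarrow>
     small_o_P M (\<lambda>n. 1 / sqrt (real n))
       (\<lambda>n \<omega>. est n \<omega> - target - emp n (\<lambda>i. X i \<omega>) D)"

definition outer_expectation :: "'w measure \<Rightarrow> ('w \<Rightarrow> real) \<Rightarrow> real" where
  "outer_expectation M T = Inf {(\<integral>\<omega>. U \<omega> \<partial>M) | U. integrable M U \<and> (\<forall>\<omega>\<in>space M. T \<omega> \<le> U \<omega>)}"

text \<open>
  The space of bounded real functions on a class, with the supremum metric and its Borel sets.
\<close>

definition l_infinity :: "'f set \<Rightarrow> ('f \<Rightarrow> real) metric" where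
  "l_infinity \<F> = funspace \<F> euclidean_metric"

definition borel_of_metric :: "'a metric \<Rightarrow> 'a measure" where
  "borel_of_metric X = sigma (mspace X) {U. openin (mtopology_of X) U}"

definition tight_borel_prob :: "'a metric \<Rightarrow> 'a measure \<Rightarrow> bool" where
  "tight_borel_prob X \<nu> \<longleftrightarrow> prob_space \<nu> \<and> sets \<nu> = sets (borel_of_metric X) \<and>
     (\<forall>\<epsilon>>0. \<exists>K. compactin (mtopology_of X) K \<and> measure \<nu> K \<ge> 1 - \<epsilon>)"

text \<open>
  Hoffmann-Jorgensen weak convergence of arbitrary maps into a metric space.
\<close>

definition weakly_converges :: "'w measure \<Rightarrow> 'a metric \<Rightarrow> (nat \<Rightarrow> 'w \<Rightarrow> 'a) \<Rightarrow> 'a measure \<Rightarrow> bool" where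
  "weakly_converges M X Z \<nu> \<longleftrightarrow>
     (\<forall>h. continuous_map (mtopology_of X) euclideanreal h \<and> bounded (h ` mspace X) \<longrightarrow>
        (\<lambda>n. outer_expectation M (\<lambda>\<omega>. h (Z n \<omega>))) \<longlonglongrightarrow> (\<integral>z. h z \<partial>\<nu>))"

definition empirical_process ::
    "'o measure \<Rightarrow> ('o \<Rightarrow> real) set \<Rightarrow> nat \<Rightarrow> (nat \<Rightarrow> 'o) \<Rightarrow> ('o \<Rightarrow> real) \<Rightarrow> real" where
  "empirical_process P0 \<F> n y =
     restrict (\<lambda>f. sqrt (real n) * (emp n y f - (\<integral>z. f z \<partial>P0))) \<F>"

text \<open>
  A class of square integrable functions is Donsker if its empirical process, on the canonical
  product space of i.i.d. sequences, converges weakly in the space of bounded functions on the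
  class to a tight Borel limit. The boundedness condition puts the empirical process in that space.
\<close>

definition Donsker_class :: "'o measure \<Rightarrow> ('o \<Rightarrow> real) set \<Rightarrow> bool" where
  "Donsker_class P0 \<F> \<longleftrightarrow>
     (\<forall>f\<in>\<F>. f \<in> borel_measurable P0 \<and> integrable P0 (\<lambda>z. (f z)\<^sup>2)) \<and>
     (\<forall>y\<in>space P0. bdd_above ((\<lambda>f. \<bar>f y - (\<integral>z. f z \<partial>P0)\<bar>) ` \<F>)) \<and>
     (\<exists>\<nu>. tight_borel_prob (l_infinity \<F>) \<nu> \<and>
        weakly_converges (Pi\<^sub>M UNIV (\<lambda>_::nat. P0)) (l_infinity \<F>) (empirical_process P0 \<F>) \<nu>)"

end

theory Submission
  imports Defs
begin

text \<open>
  The remainders telescope to \<open>R\<^sub>n(\<phi>) = \<langle>\<phi>, Q\<^sub>n - Q\<^sub>0\<^sub>,\<^sub>n\<rangle> - P\<^sub>n S(\<phi>)\<close>, so the expansion of \<open>Q\<^sub>n - Q\<^sub>0\<^sub>,\<^sub>n\<close> is its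
  expansion in the orthonormal basis, and linearity gives \<open>D\<^sub>\<Phi> = S(G)\<close> for the canonical gradient
  \<open>G\<close>. Hence \<open>P\<^sub>0 D\<^sub>\<Phi> = 0\<close> by the first order condition for \<open>Q\<^sub>0\<^sub>,\<^sub>n\<close>, and it remains to replace \<open>D\<^sub>\<Phi>\<close>
  by its limit in \<open>P\<^sub>n - P\<^sub>0\<close>.

  Asymptotic equicontinuity of the empirical process \<open>G\<^sub>n\<close> is derived without Gaussianity of the
  limit. By tightness \<open>G\<^sub>n\<close> is, up to probability \<open>\<eta>\<close>, asymptotically within \<open>a\<close> of a fixed finite
  set \<open>C\<close> of functions on the class. If some \<open>c \<in> C\<close> oscillates by \<open>3a\<close> between two functions at
  \<open>L\<^sup>2\<close>-distance \<open>\<delta>\<close>, then \<open>G\<^sub>n\<close> is near \<open>c\<close> only if it oscillates by \<open>a\<close> between the same two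
  functions, which by Chebyshev's inequality has probability at most \<open>\<delta>\<^sup>2 / a\<^sup>2\<close>. As \<open>C\<close> does not
  depend on \<open>\<delta>\<close>, these \<open>c\<close> can be discarded.
\<close>

section \<open>Subspaces, orthonormal expansions, the canonical gradient and the first order
  condition\<close>

section \<open>Linear structure and the expansions\<close>

text \<open>A linear subspace of real functions, phrased by pointwise binary combinations so that it
  matches \<open>linear_along\<close>; the zero function accounts for empty sums.\<close>

definition lin_closed :: "('x \<Rightarrow> real) set \<Rightarrow> bool" where
  "lin_closed V \<longleftrightarrow> (\<lambda>x. 0) \<in> V \<and> (\<forall>f\<in>V. \<forall>g\<in>V. \<forall>a b. (\<lambda>x. a * f x + b * g x) \<in> V)"

lemma lin_closedD:
  assumes "lin_closed V" "f \<in> V" "g \<in> V"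
  shows "(\<lambda>x. a * f x + b * g x) \<in> V"
  using assms by (simp add: lin_closed_def)

lemma linear_alongD:
  assumes "linear_along V T" "f \<in> V" "g \<in> V"
  shows "T (\<lambda>x. a * f x + b * g x) = a * T f + b * T g"
  using assms by (simp add: linear_along_def)

lemma inner_product_alongD:
  assumes "inner_product_along V ip" "f \<in> V"
  shows "g \<in> V \<Longrightarrow> ip f g = ip g f" "linear_along V (\<lambda>g. ip g f)"
    "f \<noteq> (\<lambda>x. 0) \<Longrightarrow> ip f f > 0"
  using assms by (simp_all add: inner_product_along_def)

lemma lin_closed_sum:
  assumes "lin_closed V" "\<And>j. j \<in> A \<Longrightarrow> f j \<in> V"
  shows "(\<lambda>x. \<Sum>j\<in>A. c j * f j x) \<in> V"
  using assms(2)
proof (induction A rule: infinite_finite_induct)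
  case (insert j A)
  then have "(\<lambda>x. c j * f j x + 1 * (\<Sum>j\<in>A. c j * f j x)) \<in> V"
    using lin_closedD[OF assms(1), of "f j" "\<lambda>x. \<Sum>j\<in>A. c j * f j x" "c j" 1] by simp
  with insert show ?case by simp
qed (use assms(1) in \<open>simp_all add: lin_closed_def\<close>)

lemma lin_closed_diff:
  assumes "lin_closed V" "f \<in> V" "g \<in> V"
  shows "(\<lambda>x. f x - g x) \<in> V"
proof -
  have "(\<lambda>x. 1 * f x + (-1) * g x) \<in> V"
    using assms by (rule lin_closedD)
  then show ?thesis by simp
qed

lemma linear_along_zero:
  assumes "linear_along V T" "lin_closed V"
  shows "T (\<lambda>x. 0) = 0"
proof -
  have "T (\<lambda>x. 0 * (\<lambda>x. 0) x + 0 * (\<lambda>x. 0) x) = 0 * T (\<lambda>x. 0) + 0 * T (\<lambda>x. 0)"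
    using assms(2) by (intro linear_alongD[OF assms(1)]) (simp_all add: lin_closed_def)
  then show ?thesis by simp
qed

lemma linear_along_sum:
  assumes "linear_along V T" "lin_closed V" "\<And>j. j \<in> A \<Longrightarrow> f j \<in> V"
  shows "T (\<lambda>x. \<Sum>j\<in>A. c j * f j x) = (\<Sum>j\<in>A. c j * T (f j))"
  using assms(3)
proof (induction A rule: infinite_finite_induct)
  case (insert j A)
  have "(\<lambda>x. \<Sum>j\<in>A. c j * f j x) \<in> V"
    using insert.prems by (intro lin_closed_sum[OF assms(2)]) auto
  then have "T (\<lambda>x. c j * f j x + 1 * (\<Sum>j\<in>A. c j * f j x)) =
      c j * T (f j) + 1 * T (\<lambda>x. \<Sum>j\<in>A. c j * f j x)"
    using insert.prems by (intro linear_alongD[OF assms(1)]) auto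
  with insert show ?case by simp
qed (use linear_along_zero[OF assms(1,2)] in simp_all)

lemma linear_along_add:
  assumes "linear_along V T" "f \<in> V" "g \<in> V"
  shows "T (\<lambda>x. f x + g x) = T f + T g"
proof -
  have "T (\<lambda>x. 1 * f x + 1 * g x) = 1 * T f + 1 * T g"
    using assms by (rule linear_alongD)
  then show ?thesis by simp
qed

lemma lin_closed_spline_space: "lin_closed (spline_space k R)"
proof -
  have "(\<lambda>x. a * spline k R \<beta> x + b * spline k R \<gamma> x) = spline k R (\<lambda>j. a * \<beta> j + b * \<gamma> j)" for a b \<beta> \<gamma>
    by (simp add: spline_def fun_eq_iff sum.distrib sum_distrib_left algebra_simps)
  moreover have "(\<lambda>x. 0) = spline k R (\<lambda>j. 0)"
    by (simp add: spline_def fun_eq_iff)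
  ultimately show ?thesis
    unfolding lin_closed_def spline_space_def by (auto intro: rangeI)
qed

lemma emp_diff: "emp n y (\<lambda>z. f z - g z) = emp n y f - emp n y g"
  by (simp add: emp_def sum_subtractf diff_divide_distrib)

lemma emp_sum: "emp n y (\<lambda>z. \<Sum>j\<in>A. f j z * c j) = (\<Sum>j\<in>A. emp n y (f j) * c j)"
  unfolding emp_def
  by (subst sum.swap) (simp add: sum_distrib_right sum_divide_distrib)

text \<open>The terms cancel as written: \<open>P (score L Q \<phi>)\<close> between the residual
  and \<open>E_rem\<close>, the \<open>P0\<close>-mean of the score difference between
  \<open>E_rem\<close> and \<open>R1_rem\<close>, and the \<open>dscore\<close> integral between
  \<open>R1_rem\<close> and \<open>R3_rem\<close>.\<close>

lemma coef_rem_emp: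
  "coef_rem J (emp n y) P0 L Q Q' \<phi> = J_inner J P0 L Q' \<phi> (\<lambda>x. Q x - Q' x) - emp n y (score L Q' \<phi>)"
  by (simp add: coef_rem_def score_residual_def E_rem_def R1_rem_def R3_rem_def emp_diff)

text \<open>Pairing any representation of \<open>f\<close> in the basis with \<open>\<phi> i\<close>
  isolates its coefficient.\<close>

lemma orthonormal_expansion:
  assumes "lin_closed V" "inner_product_along V ip" "orthonormal_basis_along V ip R \<phi>" "finite R" "f \<in> V"
  shows "(\<Sum>j\<in>R. ip (\<phi> j) f * \<phi> j x) = f x"
proof -
  obtain c where c: "f = (\<lambda>x. \<Sum>j\<in>R. c j * \<phi> j x)"
    using assms(3,5) unfolding orthonormal_basis_along_def by blast
  have \<phi>: "\<phi> j \<in> V" if "j \<in> R" for j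
    using assms(3) that unfolding orthonormal_basis_along_def by blast
  have "ip (\<phi> i) f = c i" if i: "i \<in> R" for i
  proof -
    \<comment> \<open>Linearity is available in the first argument only, so symmetry moves
      \<open>f\<close> there.\<close>
    have "ip (\<phi> i) f = ip f (\<phi> i)"
      by (rule inner_product_alongD(1)[OF assms(2) \<phi>[OF i] assms(5)])
    also have "\<dots> = (\<Sum>j\<in>R. c j * ip (\<phi> j) (\<phi> i))"
      unfolding c
      by (rule linear_along_sum[OF inner_product_alongD(2)[OF assms(2) \<phi>[OF i]] assms(1) \<phi>])
    also have "\<dots> = (\<Sum>j\<in>R. if j = i then c j else 0)"
      using assms(3) i unfolding orthonormal_basis_along_def by (intro sum.cong) auto
    finally show ?thesis using i assms(4) by simp
  qed
  then show ?thesis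
    \<comment> \<open>Only the \<open>f\<close> on the right is expanded; the one inside
      \<open>ip\<close> must stay for the coefficient identity to apply.\<close>
    by (subst (2) c) simp
qed

text \<open>By \<open>coef_rem_emp\<close> each basis coefficient of \<open>Q - Q'\<close> is the
  empirical mean of a score plus a coefficient remainder; the two sums are the two
  expansions.\<close>

lemma estimator_expansion:
  assumes "lin_closed V" "inner_product_along V (J_inner J P0 L Q')"
    "orthonormal_basis_along V (J_inner J P0 L Q') R \<phi>" "finite R" "Q \<in> V" "Q' \<in> V"
  shows "Q x - Q' x =
    emp n y (D_expansion L Q' R \<phi> x) + R_expansion J (emp n y) P0 L Q Q' R \<phi> x"
proof -
  have "Q x - Q' x = (\<Sum>j\<in>R. J_inner J P0 L Q' (\<phi> j) (\<lambda>x. Q x - Q' x) * \<phi> j x)"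
    by (rule orthonormal_expansion[OF assms(1-4), symmetric])
      (rule lin_closed_diff[OF assms(1,5,6)])
  also have "\<dots> = emp n y (D_expansion L Q' R \<phi> x) + R_expansion J (emp n y) P0 L Q Q' R \<phi> x"
    unfolding D_expansion_def R_expansion_def emp_sum coef_rem_emp
    by (simp add: left_diff_distrib flip: sum.distrib)
  finally show ?thesis .
qed

lemma D_expansion_in:
  assumes "lin_closed V" "orthonormal_basis_along V ip R \<phi>"
  shows "(\<lambda>x. D_expansion L Q' R \<phi> x z) \<in> V"
  unfolding D_expansion_def
  by (rule lin_closed_sum) (use assms in \<open>auto simp: orthonormal_basis_along_def\<close>)

text \<open>The empirical mean is a finite linear combination of the functions
  \<open>x \<mapsto> D_expansion L Q' R \<phi> x (y i)\<close>, all in \<open>V\<close>, so a linear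
  derivative passes through it.\<close>

lemma dirderiv_emp_D_expansion:
  assumes "lin_closed V" "orthonormal_basis_along V ip R \<phi>" "linear_along V (dirderiv \<Phi> Q')"
  shows "(\<lambda>x. emp n y (D_expansion L Q' R \<phi> x)) \<in> V"
    "dirderiv \<Phi> Q' (\<lambda>x. emp n y (D_expansion L Q' R \<phi> x)) = emp n y (D_functional \<Phi> L Q' R \<phi>)"
proof -
  note [simp] = D_expansion_in[OF assms(1,2)]
  have eq: "(\<lambda>x. emp n y (D_expansion L Q' R \<phi> x)) =
      (\<lambda>x. \<Sum>i<n. inverse (real n) * D_expansion L Q' R \<phi> x (y i))"
    by (simp add: emp_def fun_eq_iff divide_inverse mult.commute flip: sum_distrib_left)
  show "(\<lambda>x. emp n y (D_expansion L Q' R \<phi> x)) \<in> V"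
    unfolding eq
    by (rule lin_closed_sum[OF assms(1), where f = "\<lambda>i x. D_expansion L Q' R \<phi> x (y i)"]) simp
  show "dirderiv \<Phi> Q' (\<lambda>x. emp n y (D_expansion L Q' R \<phi> x)) = emp n y (D_functional \<Phi> L Q' R \<phi>)"
    unfolding eq
    by (subst linear_along_sum[OF assms(3,1), where f = "\<lambda>i x. D_expansion L Q' R \<phi> x (y i)"])
      (simp_all add: emp_def D_functional_def divide_inverse mult.commute flip: sum_distrib_left)
qed

text \<open>\<open>functional_rem\<close> is by definition the linearization error, so only the
  derivative in direction \<open>Q - Q'\<close> has to be split along the expansion of the
  estimator.\<close>

lemma functional_expansion:
  assumes "lin_closed V" "inner_product_along V (J_inner J P0 L Q')"
    "orthonormal_basis_along V (J_inner J P0 L Q') R \<phi>" "finite R" "Q \<in> V" "Q' \<in> V"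
    "linear_along V (dirderiv \<Phi> Q')"
  shows "\<Phi> Q - \<Phi> Q' = emp n y (D_functional \<Phi> L Q' R \<phi>)
     + dirderiv \<Phi> Q' (R_expansion J (emp n y) P0 L Q Q' R \<phi>) + functional_rem \<Phi> Q Q'"
proof -
  have R: "R_expansion J (emp n y) P0 L Q Q' R \<phi> \<in> V"
    unfolding R_expansion_def[abs_def]
    by (rule lin_closed_sum) (use assms in \<open>auto simp: orthonormal_basis_along_def\<close>)
  have "dirderiv \<Phi> Q' (\<lambda>x. Q x - Q' x) = dirderiv \<Phi> Q'
      (\<lambda>x. emp n y (D_expansion L Q' R \<phi> x) + R_expansion J (emp n y) P0 L Q Q' R \<phi> x)"
    by (subst estimator_expansion[OF assms(1-6)]) rule
  also have "\<dots> = emp n y (D_functional \<Phi> L Q' R \<phi>)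
      + dirderiv \<Phi> Q' (R_expansion J (emp n y) P0 L Q Q' R \<phi>)"
    by (subst linear_along_add[OF assms(7) dirderiv_emp_D_expansion(1)[OF assms(1,3,7)] R])
      (simp add: dirderiv_emp_D_expansion(2)[OF assms(1,3,7)])
  finally show ?thesis
    by (simp add: functional_rem_def)
qed

text \<open>Riesz representation in finite dimension: the coefficients of the representer are the
  values of \<open>T\<close> on the orthonormal basis.\<close>

lemma canonical_gradient_exists:
  assumes "lin_closed V" "inner_product_along V ip" "orthonormal_basis_along V ip R \<phi>" "finite R"
    "linear_along V T"
  shows "canonical_gradient V ip T (\<lambda>x. \<Sum>j\<in>R. T (\<phi> j) * \<phi> j x)"
proof -
  have \<phi>: "\<phi> j \<in> V" if "j \<in> R" for j
    using assms(3) that unfolding orthonormal_basis_along_def by blast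
  have "T h = ip (\<lambda>x. \<Sum>j\<in>R. T (\<phi> j) * \<phi> j x) h" if h: "h \<in> V" for h
  proof -
    have "T h = T (\<lambda>x. \<Sum>j\<in>R. ip (\<phi> j) h * \<phi> j x)"
      using orthonormal_expansion[OF assms(1-4) h] by simp
    also have "\<dots> = (\<Sum>j\<in>R. ip (\<phi> j) h * T (\<phi> j))"
      by (rule linear_along_sum[OF assms(5,1) \<phi>])
    also have "\<dots> = ip (\<lambda>x. \<Sum>j\<in>R. T (\<phi> j) * \<phi> j x) h"
      using linear_along_sum[OF inner_product_alongD(2)[OF assms(2) h] assms(1) \<phi>,
          of R "\<lambda>j. j" "\<lambda>j. T (\<phi> j)"] by (simp add: mult.commute)
    finally show ?thesis .
  qed
  then show ?thesis
    unfolding canonical_gradient_def by (simp add: lin_closed_sum[OF assms(1) \<phi>])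
qed

text \<open>Two representers pair equally with their own difference, which therefore has norm zero,
  against positive definiteness.\<close>

lemma canonical_gradient_unique:
  assumes "lin_closed V" "inner_product_along V ip"
    "canonical_gradient V ip T G" "canonical_gradient V ip T H"
  shows "G = H"
proof (rule ccontr)
  assume "G \<noteq> H"
  let ?d = "\<lambda>x. 1 * G x + (-1) * H x"
  have GH: "G \<in> V" "H \<in> V"
    using assms(3,4) by (auto simp: canonical_gradient_def)
  then have d: "?d \<in> V"
    by (rule lin_closedD[OF assms(1)])
  moreover have "?d \<noteq> (\<lambda>x. 0)"
    using \<open>G \<noteq> H\<close> by (auto simp: fun_eq_iff)
  ultimately have "ip ?d ?d > 0"
    by (rule inner_product_alongD(3)[OF assms(2)])
  moreover have "ip ?d ?d = 1 * ip G ?d + (-1) * ip H ?d"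
    using GH by (intro linear_alongD[OF inner_product_alongD(2)[OF assms(2) d]])
  moreover have "ip G ?d = ip H ?d"
    using assms(3,4) d unfolding canonical_gradient_def by metis
  ultimately show False by simp
qed

lemma linear_along_score:
  assumes "differentiable_along V (\<lambda>q. L q z) Q"
  shows "linear_along V (\<lambda>f. score L Q f z)"
  using assms unfolding differentiable_along_def linear_along_def score_def by simp

text \<open>Both sides are the sum over \<open>j\<close> of
  \<open>score L Q' (\<phi> j) z * dirderiv \<Phi> Q' (\<phi> j)\<close>: the left by linearity of
  the derivative with \<open>z\<close> held fixed, the right by linearity of the score in its
  direction, since uniqueness identifies \<open>G\<close> with the explicit Riesz
  representer.\<close>

lemma D_functional_eq_score:
  assumes "lin_closed V" "inner_product_along V ip" "orthonormal_basis_along V ip R \<phi>" "finite R"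
    "linear_along V (dirderiv \<Phi> Q')" "canonical_gradient V ip (dirderiv \<Phi> Q') G"
    "differentiable_along V (\<lambda>q. L q z) Q'"
  shows "D_functional \<Phi> L Q' R \<phi> z = score L Q' G z"
proof -
  have \<phi>: "\<phi> j \<in> V" if "j \<in> R" for j
    using assms(3) that unfolding orthonormal_basis_along_def by blast
  have G: "G = (\<lambda>x. \<Sum>j\<in>R. dirderiv \<Phi> Q' (\<phi> j) * \<phi> j x)"
    by (rule canonical_gradient_unique[OF assms(1,2,6) canonical_gradient_exists[OF assms(1-5)]])
  have "D_functional \<Phi> L Q' R \<phi> z = (\<Sum>j\<in>R. score L Q' (\<phi> j) z * dirderiv \<Phi> Q' (\<phi> j))"
    unfolding D_functional_def D_expansion_def by (rule linear_along_sum[OF assms(5,1) \<phi>])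
  also have "\<dots> = score L Q' G z"
    unfolding G
    by (subst linear_along_sum[OF linear_along_score[where L = L, OF assms(7)] assms(1) \<phi>])
      (auto simp: mult.commute)
  finally show ?thesis .
qed

text \<open>The line through \<open>Q\<close> in direction \<open>h\<close> stays in
  \<open>V\<close>, so the risk along it has a local minimum at 0, where its derivative is minus the
  mean score.\<close>

lemma integral_score_eq_0:
  assumes "lin_closed V" "risk_minimizer P0 L V Q" "h \<in> V" "risk_differentiable P0 L Q h"
  shows "(\<integral>z. score L Q h z \<partial>P0) = 0"
proof -
  let ?r = "\<lambda>\<delta>. \<integral>z. L (\<lambda>x. Q x + \<delta> * h x) z \<partial>P0"
  have Q: "Q \<in> V"
    and min: "\<And>q. q \<in> V \<Longrightarrow> integrable P0 (L q) \<Longrightarrow> (\<integral>z. L Q z \<partial>P0) \<le> (\<integral>z. L q z \<partial>P0)"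
    using assms(2) by (auto simp: risk_minimizer_def is_arg_min_def not_less)
  have "(\<lambda>x. Q x + \<delta> * h x) \<in> V" for \<delta>
  proof -
    have "(\<lambda>x. 1 * Q x + \<delta> * h x) \<in> V"
      using assms(1) Q assms(3) by (rule lin_closedD)
    then show ?thesis by simp
  qed
  with min have le: "?r 0 \<le> ?r \<delta>" if "integrable P0 (L (\<lambda>x. Q x + \<delta> * h x))" for \<delta>
    using that by simp
  \<comment> \<open>A minimizer is compared only with candidates of integrable loss; on this
    neighbourhood of 0 every perturbation is such a candidate.\<close>
  from assms(4) obtain d where d: "d > 0"
    "\<And>\<delta>. dist \<delta> 0 < d \<Longrightarrow> integrable P0 (L (\<lambda>x. Q x + \<delta> * h x))"
    unfolding risk_differentiable_def eventually_nhds_metric by blast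
  have "(?r has_real_derivative - (\<integral>z. score L Q h z \<partial>P0)) (at 0)"
    using assms(4) unfolding risk_differentiable_def by blast
  then have "- (\<integral>z. score L Q h z \<partial>P0) = 0"
    by (rule DERIV_local_min[OF _ d(1)]) (use d(2) le in \<open>auto simp: dist_real_def\<close>)
  then show ?thesis by simp
qed

text \<open>The support lies in the selected member of the sieve, or in \<open>Rmax\<close>, for the
  relaxed estimator by way of the support of the initial HAL-MLE. This gives the finiteness that the
  basis expansions need.\<close>

lemma finite_nonzero_estimator:
  assumes "sieve_MLE k \<R> risk \<beta> \<and> (\<forall>R\<in>\<R>. finite R) \<or>
    (HAL_MLE k Rmax C risk \<beta> \<or> relax_HAL_MLE k Rmax C risk \<beta>) \<and> finite Rmax"
  shows "finite (nonzero \<beta>)"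
  using assms unfolding sieve_MLE_def HAL_MLE_def relax_HAL_MLE_def
  by (meson finite_subset)

section \<open>Calculus of outer probabilities and a Chebyshev bound uniform in the sample
  size\<close>

section \<open>Outer probabilities and empirical means\<close>

text \<open>Each set has a measurable cover of the same outer measure, and the covers are
  subadditive.\<close>

lemma outer_measure_of_Un:
  assumes "A \<subseteq> space M" "B \<subseteq> space M"
  shows "outer_measure_of M (A \<union> B) \<le> outer_measure_of M A + outer_measure_of M B"
proof -
  obtain E F where E: "E \<in> sets M" "A \<subseteq> E" "outer_measure_of M A = emeasure M E"
    and F: "F \<in> sets M" "B \<subseteq> F" "outer_measure_of M B = emeasure M F"
    using outer_measure_of_attain[OF assms(1)] outer_measure_of_attain[OF assms(2)] by auto
  have "outer_measure_of M (A \<union> B) \<le> outer_measure_of M (E \<union> F)"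
    using E F by (intro outer_measure_of_mono) auto
  also have "\<dots> \<le> emeasure M E + emeasure M F"
    using E F by (simp add: emeasure_subadditive)
  finally show ?thesis using E F by simp
qed

lemma outer_measure_of_le:
  assumes "A \<subseteq> B" "B \<in> sets M" "emeasure M B \<le> c"
  shows "outer_measure_of M A \<le> c"
  using outer_measure_of_mono[OF assms(1), of M] assms(2,3) by simp

text \<open>The preimage of a measurable cover is a measurable cover of the preimage. Only an
  inequality is claimed: a measurable cover in \<open>M\<close> need not be a preimage under
  \<open>T\<close>.\<close>

lemma outer_measure_of_distr:
  assumes T: "T \<in> measurable M N"
  shows "outer_measure_of M {\<omega>\<in>space M. P (T \<omega>)} \<le> outer_measure_of (distr M N T) {y\<in>space N. P y}"
proof -
  obtain E where E: "E \<in> sets N" "{y\<in>space N. P y} \<subseteq> E"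
    "outer_measure_of (distr M N T) {y\<in>space N. P y} = emeasure (distr M N T) E"
    using outer_measure_of_attain[of "{y\<in>space N. P y}" "distr M N T"] by auto
  have "outer_measure_of M {\<omega>\<in>space M. P (T \<omega>)} \<le> emeasure M (T -` E \<inter> space M)"
    using E measurable_space[OF T] measurable_sets[OF T E(1)]
    by (intro outer_measure_of_le[OF _ _ order_refl]) auto
  also have "\<dots> = emeasure (distr M N T) E"
    using E T by (simp add: emeasure_distr)
  finally show ?thesis using E by simp
qed

lemma prob_tends_to_0_mono:
  assumes "prob_tends_to_0 M F" "\<forall>\<^sub>F n in sequentially. \<forall>\<omega>\<in>space M. E n \<omega> \<longrightarrow> F n \<omega>"
  shows "prob_tends_to_0 M E"
  unfolding prob_tends_to_0_def
proof (rule tendsto_sandwich[OF _ _ tendsto_const])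
  show "(\<lambda>n. outer_measure_of M {\<omega>\<in>space M. F n \<omega>}) \<longlonglongrightarrow> 0"
    using assms(1) by (simp add: prob_tends_to_0_def)
  show "\<forall>\<^sub>F n in sequentially.
      outer_measure_of M {\<omega>\<in>space M. E n \<omega>} \<le> outer_measure_of M {\<omega>\<in>space M. F n \<omega>}"
    using assms(2) by eventually_elim (auto intro: outer_measure_of_mono)
qed simp

lemma prob_tends_to_0_disj:
  assumes "prob_tends_to_0 M E" "prob_tends_to_0 M F"
  shows "prob_tends_to_0 M (\<lambda>n \<omega>. E n \<omega> \<or> F n \<omega>)"
  unfolding prob_tends_to_0_def
proof (rule tendsto_sandwich[OF _ _ tendsto_const])
  show "(\<lambda>n. outer_measure_of M {\<omega>\<in>space M. E n \<omega>} + outer_measure_of M {\<omega>\<in>space M. F n \<omega>}) \<longlonglongrightarrow> 0"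
    using tendsto_add[OF assms[unfolded prob_tends_to_0_def]] by simp
  have "{\<omega>\<in>space M. E n \<omega> \<or> F n \<omega>} = {\<omega>\<in>space M. E n \<omega>} \<union> {\<omega>\<in>space M. F n \<omega>}" for n
    by auto
  then show "\<forall>\<^sub>F n in sequentially. outer_measure_of M {\<omega>\<in>space M. E n \<omega> \<or> F n \<omega>}
      \<le> outer_measure_of M {\<omega>\<in>space M. E n \<omega>} + outer_measure_of M {\<omega>\<in>space M. F n \<omega>}"
    by (simp add: outer_measure_of_Un)
qed simp

text \<open>An event of outer probability below 1 misses a point. This extracts deterministic facts
  from convergence in probability by looking at one sample point.\<close>

lemma prob_tends_to_0_exists:
  assumes "prob_space M" "prob_tends_to_0 M E"
  obtains n \<omega> where "n \<ge> N" "\<omega> \<in> space M" "\<not> E n \<omega>"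
proof -
  interpret prob_space M by fact
  have "\<forall>\<^sub>F n in sequentially. outer_measure_of M {\<omega>\<in>space M. E n \<omega>} < 1"
    using assms(2) unfolding prob_tends_to_0_def by (rule order_tendstoD) simp
  then obtain n where n: "n \<ge> N" "outer_measure_of M {\<omega>\<in>space M. E n \<omega>} < 1"
    unfolding eventually_sequentially by (meson nle_le)
  have "{\<omega>\<in>space M. E n \<omega>} \<noteq> space M"
    using n(2) by (auto simp: emeasure_space_1)
  then show thesis using that n(1) by blast
qed

lemma prob_tends_to_0I:
  assumes "\<And>e::real. e > 0 \<Longrightarrow>
    \<forall>\<^sub>F n in sequentially. outer_measure_of M {\<omega>\<in>space M. E n \<omega>} \<le> ennreal e"
  shows "prob_tends_to_0 M E"
  unfolding prob_tends_to_0_def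
proof (rule order_tendstoI)
  fix a :: ennreal assume "0 < a"
  \<comment> \<open>An intermediate bound is finite even when \<open>a\<close> is infinite, hence a
    real number.\<close>
  then obtain b where b: "0 < b" "b < a" using dense by blast
  then obtain e where e: "0 \<le> e" "b = ennreal e" by (cases b) auto
  with b have "e > 0" by (simp add: ennreal_less_zero_iff)
  from assms[OF this] show "\<forall>\<^sub>F n in sequentially. outer_measure_of M {\<omega>\<in>space M. E n \<omega>} < a"
    by eventually_elim (use b e in auto)
qed simp

lemma small_o_P_add:
  assumes "small_o_P M a X" "small_o_P M a Y"
  shows "small_o_P M a (\<lambda>n \<omega>. X n \<omega> + Y n \<omega>)"
  unfolding small_o_P_def
proof (intro allI impI)
  fix \<epsilon> :: real assume "\<epsilon> > 0"
  then have "prob_tends_to_0 M (\<lambda>n \<omega>. \<bar>X n \<omega>\<bar> > \<epsilon> / 2 * a n \<or> \<bar>Y n \<omega>\<bar> > \<epsilon> / 2 * a n)"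
    using assms unfolding small_o_P_def by (intro prob_tends_to_0_disj) (meson half_gt_zero)+
  then show "prob_tends_to_0 M (\<lambda>n \<omega>. \<bar>X n \<omega> + Y n \<omega>\<bar> > \<epsilon> * a n)"
    by (rule prob_tends_to_0_mono) (auto intro!: always_eventually)
qed

lemma small_o_P_cong:
  assumes "small_o_P M a X" "\<And>n \<omega>. n \<ge> 1 \<Longrightarrow> \<omega> \<in> space M \<Longrightarrow> X n \<omega> = Y n \<omega>"
  shows "small_o_P M a Y"
  unfolding small_o_P_def
proof (intro allI impI)
  fix \<epsilon> :: real assume "\<epsilon> > 0"
  then have "prob_tends_to_0 M (\<lambda>n \<omega>. \<bar>X n \<omega>\<bar> > \<epsilon> * a n)"
    using assms(1) by (simp add: small_o_P_def)
  then show "prob_tends_to_0 M (\<lambda>n \<omega>. \<bar>Y n \<omega>\<bar> > \<epsilon> * a n)"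
    by (rule prob_tends_to_0_mono)
      (use assms(2) in \<open>auto intro!: eventually_mono[OF eventually_ge_at_top[of 1]]\<close>)
qed

text \<open>In the induction the cross term has mean zero, because the new summand is centred and
  independent of the partial sum. Integrability is carried along to split the expectation.\<close>

lemma (in prob_space) second_moment_sum_indep:
  fixes X :: "nat \<Rightarrow> 'a \<Rightarrow> real"
  assumes indep: "indep_vars (\<lambda>_. borel) X UNIV"
    and sq: "\<And>i. integrable M (\<lambda>\<omega>. (X i \<omega>)\<^sup>2)"
    and mean: "\<And>i. expectation (X i) = 0" and var: "\<And>i. expectation (\<lambda>\<omega>. (X i \<omega>)\<^sup>2) = v"
  shows "integrable M (\<lambda>\<omega>. (\<Sum>i<n. X i \<omega>)\<^sup>2) \<and> expectation (\<lambda>\<omega>. (\<Sum>i<n. X i \<omega>)\<^sup>2) = real n * v"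
proof (induction n)
  case (Suc n)
  have meas: "X i \<in> borel_measurable M" for i
    using indep by (auto simp: indep_vars_def)
  have int: "integrable M (X i)" for i
    using square_integrable_imp_integrable[OF meas sq] .
  let ?S = "\<lambda>\<omega>. \<Sum>i<n. X i \<omega>"
  have intS: "integrable M ?S"
    using int by (intro Bochner_Integration.integrable_sum)
  have "indep_vars (\<lambda>_. borel) X (insert n {..<n})"
    using indep by (rule indep_vars_subset) simp
  then have ind: "indep_var borel (X n) borel ?S"
    by (intro indep_vars_sum) auto
  note prod = indep_var_integrable[OF ind int intS] indep_var_lebesgue_integral[OF ind int intS]
  have eq: "(\<Sum>i<Suc n. X i \<omega>)\<^sup>2 = (?S \<omega>)\<^sup>2 + 2 * (X n \<omega> * ?S \<omega>) + (X n \<omega>)\<^sup>2" for \<omega>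
    by (simp add: power2_sum algebra_simps)
  show ?case
    unfolding eq using Suc prod sq mean var by (simp add: algebra_simps)
qed simp

lemma emp_centered:
  assumes "n > 0"
  shows "emp n y u - c = (\<Sum>i<n. u (y i) - c) / real n"
  using assms by (simp add: emp_def sum_subtractf field_simps)

text \<open>The second moment of the scaled, centred mean is the variance of \<open>u\<close> for
  every \<open>n > 0\<close>, so the bound depends only on the \<open>L2\<close> norm of
  \<open>u\<close>. It is later applied to differences of functions that are close in mean
  square.\<close>

lemma emp_Chebyshev:
  assumes "prob_space M" "prob_space P0" "prob_space.indep_vars M (\<lambda>_. P0) Obs UNIV"
    "\<forall>i. distr M P0 (Obs i) = P0"
    and u[measurable]: "u \<in> borel_measurable P0" and sq: "integrable P0 (\<lambda>z. (u z)\<^sup>2)" and "a > 0"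
  shows "outer_measure_of M {\<omega>\<in>space M. a \<le> \<bar>sqrt (real n) * (emp n (\<lambda>i. Obs i \<omega>) u - (\<integral>z. u z \<partial>P0))\<bar>}
    \<le> ennreal ((\<integral>z. (u z)\<^sup>2 \<partial>P0) / a\<^sup>2)"
proof (cases "n = 0")
  \<comment> \<open>The factor \<open>sqrt 0\<close> makes the event empty, as
    \<open>a > 0\<close>.\<close>
  case True
  then show ?thesis using \<open>a > 0\<close> by simp
next
  case False
  interpret prob_space M by fact
  interpret P: prob_space P0 by fact
  have Obs[measurable]: "Obs i \<in> measurable M P0" for i
    using assms(3) by (auto simp: indep_vars_def)
  define m where "m = (\<integral>z. u z \<partial>P0)"
  have int: "integrable P0 u"
    by (rule P.square_integrable_imp_integrable[OF u sq])
  have var: "integrable P0 (\<lambda>z. (u z - m)\<^sup>2)" "(\<integral>z. (u z - m)\<^sup>2 \<partial>P0) \<le> (\<integral>z. (u z)\<^sup>2 \<partial>P0)"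
  proof -
    have eq: "(u z - m)\<^sup>2 = (u z)\<^sup>2 - 2 * m * u z + m\<^sup>2" for z
      by (simp add: power2_diff)
    show "integrable P0 (\<lambda>z. (u z - m)\<^sup>2)"
      unfolding eq using int sq by simp
    show "(\<integral>z. (u z - m)\<^sup>2 \<partial>P0) \<le> (\<integral>z. (u z)\<^sup>2 \<partial>P0)"
      using P.variance_eq[OF int sq] by (simp add: m_def)
  qed
  define X where "X i \<omega> = u (Obs i \<omega>) - m" for i \<omega>
  have distr: "integrable M (\<lambda>\<omega>. g (Obs i \<omega>)) = integrable P0 g"
    "expectation (\<lambda>\<omega>. g (Obs i \<omega>)) = (\<integral>z. g z \<partial>P0)" if [measurable]: "g \<in> borel_measurable P0" for g :: "_ \<Rightarrow> real" and i
    using integrable_distr_eq[of "Obs i" M P0 g] integral_distr[of "Obs i" M P0 g] assms(4) by auto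
  have "indep_vars (\<lambda>_. borel) X UNIV"
    unfolding X_def by (rule indep_vars_compose2[OF assms(3)]) simp
  moreover have "integrable M (\<lambda>\<omega>. (X i \<omega>)\<^sup>2)" "expectation (X i) = 0"
    "expectation (\<lambda>\<omega>. (X i \<omega>)\<^sup>2) = (\<integral>z. (u z - m)\<^sup>2 \<partial>P0)" for i
    using distr[of "\<lambda>z. (u z - m)\<^sup>2"] distr(2)[of "\<lambda>z. u z - m"] var(1) int
    unfolding X_def by (auto simp: m_def P.prob_space)
  ultimately have S: "integrable M (\<lambda>\<omega>. (\<Sum>i<n. X i \<omega>)\<^sup>2)"
    "expectation (\<lambda>\<omega>. (\<Sum>i<n. X i \<omega>)\<^sup>2) = real n * (\<integral>z. (u z - m)\<^sup>2 \<partial>P0)"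
    using second_moment_sum_indep by blast+
  let ?Y = "\<lambda>\<omega>. sqrt (real n) * (emp n (\<lambda>i. Obs i \<omega>) u - m)"
  \<comment> \<open>The factor \<open>sqrt n\<close> leaves one division by \<open>n\<close>, which
    cancels the \<open>n\<close> in the second moment of the sum.\<close>
  have Y2: "(?Y \<omega>)\<^sup>2 = (\<Sum>i<n. X i \<omega>)\<^sup>2 / real n" for \<omega>
    using False by (simp add: emp_centered X_def power_mult_distrib power_divide) (simp add: power2_eq_square)
  have Y: "integrable M (\<lambda>\<omega>. (?Y \<omega>)\<^sup>2)" "expectation (\<lambda>\<omega>. (?Y \<omega>)\<^sup>2) \<le> (\<integral>z. (u z)\<^sup>2 \<partial>P0)"
    unfolding Y2 using S var(2) False by simp_all
  have "{\<omega>\<in>space M. a \<le> \<bar>?Y \<omega>\<bar>} \<subseteq> {\<omega>\<in>space M. a\<^sup>2 \<le> (?Y \<omega>)\<^sup>2}"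
    using \<open>a > 0\<close> by (auto simp flip: abs_le_square_iff)
  moreover have "{\<omega>\<in>space M. a\<^sup>2 \<le> (?Y \<omega>)\<^sup>2} \<in> sets M"
    unfolding emp_def by measurable
  moreover have "emeasure M {\<omega>\<in>space M. a\<^sup>2 \<le> (?Y \<omega>)\<^sup>2} \<le> ennreal ((\<integral>z. (u z)\<^sup>2 \<partial>P0) / a\<^sup>2)"
  proof -
    have "emeasure M {\<omega>\<in>space M. a\<^sup>2 \<le> (?Y \<omega>)\<^sup>2} \<le> ennreal (1 / a\<^sup>2 * expectation (\<lambda>\<omega>. (?Y \<omega>)\<^sup>2))"
      by (rule integral_Markov_inequality[OF Y(1)]) (use \<open>a > 0\<close> in auto)
    also have "\<dots> \<le> ennreal ((\<integral>z. (u z)\<^sup>2 \<partial>P0) / a\<^sup>2)"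
      using Y(2) by (intro ennreal_leI) (simp add: divide_right_mono)
    finally show ?thesis .
  qed
  ultimately show ?thesis
    unfolding m_def by (rule outer_measure_of_le)
qed

section \<open>Tightness of the limit and finite nets for the empirical process\<close>

section \<open>Donsker classes\<close>

text \<open>The triangle inequality makes the distance to \<open>c\<close> Lipschitz with constant
  1.\<close>

lemma continuous_map_mdist_left:
  assumes "c \<in> mspace X"
  shows "continuous_map (mtopology_of X) euclideanreal (\<lambda>z. mdist X z c)"
proof -
  have "\<bar>mdist X x c - mdist X y c\<bar> \<le> 1 * mdist X x y" if "x \<in> mspace X" "y \<in> mspace X" for x y
    using mdist_triangle[of x X y c] mdist_triangle[of y X x c] mdist_commute[of X x y] assms that
    by simp
  then have "Lipschitz_continuous_map X euclidean_metric (\<lambda>z. mdist X z c)"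
    unfolding Lipschitz_continuous_map_def by (auto simp: dist_real_def intro!: exI[of _ 1])
  then have "continuous_map (mtopology_of X) (mtopology_of euclidean_metric) (\<lambda>z. mdist X z c)"
    by (intro Cauchy_continuous_imp_continuous_map uniformly_imp_Cauchy_continuous_map
        Lipschitz_imp_uniformly_continuous_map)
  then show ?thesis by simp
qed

text \<open>A compact set carrying most of the limit mass has a finite
  \<open>\<epsilon>\<close>-net. A continuous function that vanishes near the net and is 1 at
  distance \<open>2 * \<epsilon>\<close> from it carries the mass bound over to the converging
  maps.\<close>

lemma tight_limit_near_finite_net:
  assumes "prob_space N" "weakly_converges N X Z \<nu>" "tight_borel_prob X \<nu>" "\<epsilon> > 0" "\<eta> > 0"
  obtains C where "finite C" "C \<subseteq> mspace X"
    "\<forall>\<^sub>F n in sequentially.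
       outer_measure_of N {y\<in>space N. \<forall>c\<in>C. 2 * \<epsilon> \<le> mdist X (Z n y) c} \<le> ennreal \<eta>"
proof -
  interpret N: prob_space N by fact
  interpret \<nu>: prob_space \<nu> using assms(3) by (simp add: tight_borel_prob_def)
  interpret Metric_space "mspace X" "mdist X" by simp
  have sets_\<nu>: "sets \<nu> = sets (borel_of_metric X)"
    using assms(3) by (simp add: tight_borel_prob_def)
  have "{U. openin (mtopology_of X) U} \<subseteq> Pow (mspace X)"
    using openin_subset by fastforce
  then have sets: "sets (borel_of_metric X) = sigma_sets (mspace X) {U. openin (mtopology_of X) U}"
    "space (borel_of_metric X) = mspace X"
    by (simp_all add: borel_of_metric_def)
  have space: "space \<nu> = mspace X"
    using sets_eq_imp_space_eq[OF sets_\<nu>] sets(2) by simp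
  have "\<forall>\<epsilon>>0. \<exists>K. compactin (mtopology_of X) K \<and> measure \<nu> K \<ge> 1 - \<epsilon>"
    using assms(3) by (simp add: tight_borel_prob_def)
  \<comment> \<open>The mass outside is at most \<open>\<eta> / 2\<close>, so that the limit of the
    outer expectations lies strictly below \<open>\<eta>\<close>.\<close>
  from this[rule_format, OF half_gt_zero[OF assms(5)]]
  obtain K where K: "compactin (mtopology_of X) K" "measure \<nu> K \<ge> 1 - \<eta> / 2"
    by (elim exE conjE)
  from K(1) have "mtotally_bounded K"
    unfolding mtopology_of_def by (rule compactin_imp_mtotally_bounded)
  from this[unfolded mtotally_bounded_def, rule_format, OF assms(4)]
  obtain C where C: "finite C" "C \<subseteq> K" "K \<subseteq> (\<Union>c\<in>C. mball c \<epsilon>)"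
    by (elim exE conjE)
  have CX: "C \<subseteq> mspace X"
    using C(2) compactin_subset_topspace[OF K(1)] by auto
  define A where "A = (\<Union>c\<in>C. mball c \<epsilon>)"
  have "openin (mtopology_of X) A"
    unfolding A_def mtopology_of_def by (intro openin_Union) auto
  then have A: "A \<in> sets \<nu>"
    by (simp add: sets_\<nu> sets sigma_sets.Basic)
  have "measure \<nu> K \<le> measure \<nu> A"
    using C(3) A unfolding A_def by (rule \<nu>.finite_measure_mono)
  with K(2) have \<nu>A: "measure \<nu> A \<ge> 1 - \<eta> / 2" by simp
  \<comment> \<open>Each factor rises from 0 at distance \<open>\<epsilon>\<close> from
    \<open>c\<close> to 1 at distance \<open>2 * \<epsilon>\<close>; the product is 0 near some net
    point and 1 far from all of them.\<close>
  define h where "h z = (\<Prod>c\<in>C. max 0 (min 1 (mdist X z c / \<epsilon> - 1)))" for z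
  have h01: "0 \<le> h z" "h z \<le> 1" for z
    unfolding h_def by (auto intro!: prod_nonneg prod_le_1)
  have "continuous_map (mtopology_of X) euclideanreal h"
    unfolding h_def[abs_def] divide_inverse using CX
    by (intro continuous_map_prod continuous_map_real_max continuous_map_real_min C(1)
        continuous_map_diff continuous_map_real_mult continuous_map_mdist_left) auto
  moreover have "bounded (h ` mspace X)"
    by (rule boundedI[of _ 1]) (use h01 in auto)
  ultimately have "(\<lambda>n. outer_expectation N (\<lambda>y. h (Z n y))) \<longlonglongrightarrow> (\<integral>z. h z \<partial>\<nu>)"
    using assms(2) unfolding weakly_converges_def by blast
  moreover have "(\<integral>z. h z \<partial>\<nu>) < \<eta>"
  proof -
    have "(\<integral>z. h z \<partial>\<nu>) \<le> (\<integral>z. indicator (space \<nu> - A) z \<partial>\<nu>)"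
    proof (rule integral_mono')
      fix z assume z: "z \<in> space \<nu>"
      show "h z \<le> indicator (space \<nu> - A) z"
      proof (cases "z \<in> A")
        case True
        then obtain c where c: "c \<in> C" "mdist X c z < \<epsilon>"
          by (auto simp: A_def)
        then have "mdist X z c / \<epsilon> - 1 \<le> 0"
          using assms(4) by (simp add: mdist_commute[of X z c])
        then have "max 0 (min 1 (mdist X z c / \<epsilon> - 1)) = 0"
          by simp
        then have "h z = 0"
          unfolding h_def using c(1) C(1) by (intro prod_zero) blast+
        then show ?thesis by simp
      qed (use z h01(2) in simp)
    qed (use A in \<open>auto simp: integrable_indicator_iff less_top[symmetric]\<close>)
    also have "\<dots> = 1 - measure \<nu> A"
      using A \<nu>.prob_compl by simp
    finally show ?thesis using \<nu>A assms(5) by linarith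
  qed
  ultimately have "\<forall>\<^sub>F n in sequentially. outer_expectation N (\<lambda>y. h (Z n y)) < \<eta>"
    by (rule order_tendstoD)
  then have "\<forall>\<^sub>F n in sequentially.
    outer_measure_of N {y\<in>space N. \<forall>c\<in>C. 2 * \<epsilon> \<le> mdist X (Z n y) c} \<le> ennreal \<eta>"
  proof eventually_elim
    case (elim n)
    \<comment> \<open>The constant 1 shows that the infimum is over a nonempty set, so being below
      \<open>\<eta>\<close> yields an integrable majorant \<open>U\<close> with integral below
      \<open>\<eta>\<close>. Since \<open>U\<close> is at least 1 on the far event, Markov's
      inequality finishes.\<close>
    have "integrable N (\<lambda>_. 1::real)" "\<forall>y\<in>space N. h (Z n y) \<le> 1"
      using h01 by auto
    then have "{(\<integral>y. U y \<partial>N) | U. integrable N U \<and> (\<forall>y\<in>space N. h (Z n y) \<le> U y)} \<noteq> {}"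
      by blast
    from cInf_lessD[OF this elim[unfolded outer_expectation_def]]
    obtain U where U: "integrable N U" "\<forall>y\<in>space N. h (Z n y) \<le> U y" "(\<integral>y. U y \<partial>N) < \<eta>"
      by blast
    have "h (Z n y) = 1" if "\<forall>c\<in>C. 2 * \<epsilon> \<le> mdist X (Z n y) c" for y
    proof -
      have "1 \<le> mdist X (Z n y) c / \<epsilon> - 1" if "c \<in> C" for c
        using \<open>\<forall>c\<in>C. _\<close> that assms(4) by (simp add: field_simps)
      then show ?thesis unfolding h_def by (intro prod.neutral) auto
    qed
    then have "{y\<in>space N. \<forall>c\<in>C. 2 * \<epsilon> \<le> mdist X (Z n y) c} \<subseteq> {y\<in>space N. 1 \<le> U y}"
      using U(2) by force
    moreover have "{y\<in>space N. 1 \<le> U y} \<in> sets N"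
      using U(1) by measurable
    moreover have "emeasure N {y\<in>space N. 1 \<le> U y} \<le> ennreal (1 / 1 * (\<integral>y. U y \<partial>N))"
      by (rule integral_Markov_inequality[OF U(1)]) (use U(2) h01 order_trans in \<open>auto, blast\<close>)
    then have "emeasure N {y\<in>space N. 1 \<le> U y} \<le> ennreal \<eta>"
      using U(3) by (simp add: order_trans ennreal_leI)
    ultimately show ?case by (rule outer_measure_of_le)
  qed
  with C(1) CX show thesis by (rule that)
qed

lemma l_infinity_dist:
  assumes "z \<in> mspace (l_infinity \<F>)" "w \<in> mspace (l_infinity \<F>)" "f \<in> \<F>"
  shows "\<bar>z f - w f\<bar> \<le> mdist (l_infinity \<F>) z w"
proof -
  have "mdist (l_infinity \<F>) z w = (SUP f\<in>\<F>. dist (z f) (w f))"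
    using assms by (auto simp: l_infinity_def Met_TC.fdist_def)
  moreover have "bdd_above ((\<lambda>f. dist (z f) (w f)) ` \<F>)"
    using assms by (intro Met_TC.bdd_above_dist) (auto simp: l_infinity_def)
  ultimately show ?thesis
    using cSUP_upper[OF assms(3), of "\<lambda>f. dist (z f) (w f)"] by (simp add: dist_real_def)
qed

text \<open>The bound over the class may depend on the observed point, but only \<open>n\<close>
  points enter, so the average of their bounds serves all of the class.\<close>

lemma empirical_process_in_l_infinity:
  assumes "\<And>i. i < n \<Longrightarrow> bdd_above ((\<lambda>f. \<bar>f (y i) - (\<integral>z. f z \<partial>P0)\<bar>) ` \<F>)"
  shows "empirical_process P0 \<F> n y \<in> mspace (l_infinity \<F>)"
proof -
  obtain B where B: "\<And>i f. i < n \<Longrightarrow> f \<in> \<F> \<Longrightarrow> \<bar>f (y i) - (\<integral>z. f z \<partial>P0)\<bar> \<le> B i"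
    using assms unfolding bdd_above_def by (simp add: image_iff) metis
  have "\<bar>sqrt (real n) * (emp n y f - (\<integral>z. f z \<partial>P0))\<bar> \<le> sqrt (real n) * ((\<Sum>i<n. B i) / real n)"
    if f: "f \<in> \<F>" for f
  proof (cases "n = 0")
    case False
    have "\<bar>\<Sum>i<n. f (y i) - (\<integral>z. f z \<partial>P0)\<bar> \<le> (\<Sum>i<n. B i)"
      using B f by (intro order_trans[OF sum_abs] sum_mono) auto
    then show ?thesis
      using False by (simp add: emp_centered abs_mult divide_right_mono mult_left_mono)
  qed simp
  then have "bounded (empirical_process P0 \<F> n y ` \<F>)"
    by (auto simp: empirical_process_def intro!: boundedI)
  then show ?thesis
    by (simp add: l_infinity_def Met_TC.fspace_def empirical_process_def)
qed

section \<open>Mean square distances\<close>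

lemma integrable_sq_diff:
  fixes f g :: "'a \<Rightarrow> real"
  assumes [measurable]: "f \<in> borel_measurable M" "g \<in> borel_measurable M"
    and "integrable M (\<lambda>z. (f z)\<^sup>2)" "integrable M (\<lambda>z. (g z)\<^sup>2)"
  shows "integrable M (\<lambda>z. (f z - g z)\<^sup>2)"
proof (rule Bochner_Integration.integrable_bound)
  show "integrable M (\<lambda>z. 2 * (f z)\<^sup>2 + 2 * (g z)\<^sup>2)"
    using assms by simp
  have "(f z - g z)\<^sup>2 \<le> 2 * (f z)\<^sup>2 + 2 * (g z)\<^sup>2" for z
    using zero_le_power2[of "f z + g z"] by (simp add: power2_eq_square algebra_simps)
  then show "AE z in M. norm ((f z - g z)\<^sup>2) \<le> norm (2 * (f z)\<^sup>2 + 2 * (g z)\<^sup>2)"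
    by (intro AE_I2) (simp add: order_trans[OF _ abs_ge_self])
qed simp

text \<open>Passes from the extended nonnegative integral, in which convergence is stated, to
  Bochner integrals: a finite value gives integrability.\<close>

lemma L2_close:
  fixes f g :: "'a \<Rightarrow> real"
  assumes [measurable]: "f \<in> borel_measurable M" "g \<in> borel_measurable M"
    and f: "integrable M (\<lambda>z. (f z)\<^sup>2)"
    and d: "(\<integral>\<^sup>+z. ennreal ((f z - g z)\<^sup>2) \<partial>M) \<le> ennreal d" "0 \<le> d"
  shows "integrable M (\<lambda>z. (g z)\<^sup>2)" "integrable M (\<lambda>z. (f z - g z)\<^sup>2)"
    "(\<integral>z. (f z - g z)\<^sup>2 \<partial>M) \<le> d"
proof -
  show int: "integrable M (\<lambda>z. (f z - g z)\<^sup>2)"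
    using d(1) by (intro integrableI_bounded) (auto simp: order_le_less_trans)
  show "(\<integral>z. (f z - g z)\<^sup>2 \<partial>M) \<le> d"
    using d int by (simp add: nn_integral_eq_integral)
  show "integrable M (\<lambda>z. (g z)\<^sup>2)"
    using integrable_sq_diff[OF assms(1) _ f int] by simp
qed

text \<open>The triangle inequality for squared distances, at the price of a factor 2 on each side;
  this produces the radius \<open>4 * \<delta>\<close> used later.\<close>

lemma integral_sq_triangle:
  fixes f g h :: "'a \<Rightarrow> real"
  assumes "integrable M (\<lambda>z. (f z - h z)\<^sup>2)" "integrable M (\<lambda>z. (g z - h z)\<^sup>2)"
    "integrable M (\<lambda>z. (f z - g z)\<^sup>2)"
  shows "(\<integral>z. (f z - g z)\<^sup>2 \<partial>M) \<le> 2 * (\<integral>z. (f z - h z)\<^sup>2 \<partial>M) + 2 * (\<integral>z. (g z - h z)\<^sup>2 \<partial>M)"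
proof -
  have *: "(f z - g z)\<^sup>2 \<le> 2 * (f z - h z)\<^sup>2 + 2 * (g z - h z)\<^sup>2" for z
    using zero_le_power2[of "f z - h z + (g z - h z)"] by (simp add: power2_eq_square algebra_simps)
  have "(\<integral>z. (f z - g z)\<^sup>2 \<partial>M) \<le> (\<integral>z. 2 * (f z - h z)\<^sup>2 + 2 * (g z - h z)\<^sup>2 \<partial>M)"
    using assms * by (intro integral_mono) auto
  then show ?thesis using assms by simp
qed

text \<open>The Donsker property speaks about the canonical product space; the law of the whole data
  sequence is that product measure, so the net bound pulls back to \<open>M\<close>.\<close>

lemma Donsker_net:
  fixes \<F> :: "('o \<Rightarrow> real) set" and Obs :: "nat \<Rightarrow> 'w \<Rightarrow> 'o"
  assumes "prob_space P0" "Donsker_class P0 \<F>" "prob_space M"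
    "prob_space.indep_vars M (\<lambda>_. P0) Obs UNIV" "\<forall>i. distr M P0 (Obs i) = P0" "\<epsilon> > 0" "\<eta> > 0"
  obtains C :: "(('o \<Rightarrow> real) \<Rightarrow> real) set" where "finite C"
    "\<forall>\<^sub>F n in sequentially. outer_measure_of M {\<omega>\<in>space M. \<not> (\<exists>c\<in>C. \<forall>f\<in>\<F>.
       \<bar>empirical_process P0 \<F> n (\<lambda>i. Obs i \<omega>) f - c f\<bar> < \<epsilon>)} \<le> ennreal \<eta>"
proof -
  interpret prob_space M by fact
  interpret P: prob_space P0 by fact
  let ?N = "Pi\<^sub>M UNIV (\<lambda>_::nat. P0)" and ?X = "l_infinity \<F>"
  define T where "T \<omega> i = Obs i \<omega>" for \<omega> i
  have Obs: "Obs i \<in> measurable M P0" for i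
    using assms(4) by (auto simp: indep_vars_def)
  have T: "T \<in> measurable M ?N"
    unfolding T_def by (rule measurable_PiM_single') (use Obs measurable_space[OF Obs] in auto)
  have "distr M ?N T = ?N"
    using indep_vars_iff_distr_eq_PiM[of UNIV Obs "\<lambda>_. P0"] Obs assms(4,5)
    by (simp add: T_def[abs_def] restrict_UNIV)
  obtain \<nu> where \<nu>: "tight_borel_prob ?X \<nu>" "weakly_converges ?N ?X (empirical_process P0 \<F>) \<nu>"
    and bdd: "\<And>y. y \<in> space P0 \<Longrightarrow> bdd_above ((\<lambda>f. \<bar>f y - (\<integral>z. f z \<partial>P0)\<bar>) ` \<F>)"
    using assms(2) unfolding Donsker_class_def by (elim conjE exE) simp
  have N: "prob_space ?N"
    by (intro prob_space_PiM assms(1))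
  obtain C where C: "finite C" "C \<subseteq> mspace ?X"
    and ev: "\<forall>\<^sub>F n in sequentially. outer_measure_of ?N
       {y\<in>space ?N. \<forall>c\<in>C. 2 * (\<epsilon> / 2) \<le> mdist ?X (empirical_process P0 \<F> n y) c} \<le> ennreal \<eta>"
    by (rule tight_limit_near_finite_net[OF N \<nu>(2,1) half_gt_zero[OF assms(6)] assms(7)])
  from ev have "\<forall>\<^sub>F n in sequentially. outer_measure_of M {\<omega>\<in>space M. \<not> (\<exists>c\<in>C. \<forall>f\<in>\<F>.
       \<bar>empirical_process P0 \<F> n (\<lambda>i. Obs i \<omega>) f - c f\<bar> < \<epsilon>)} \<le> ennreal \<eta>"
  proof eventually_elim
    case (elim n)
    let ?far = "\<lambda>y. \<forall>c\<in>C. \<epsilon> \<le> mdist ?X (empirical_process P0 \<F> n y) c"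
    have "\<exists>c\<in>C. \<forall>f\<in>\<F>. \<bar>empirical_process P0 \<F> n (\<lambda>i. Obs i \<omega>) f - c f\<bar> < \<epsilon>"
      if "\<omega> \<in> space M" "\<not> ?far (T \<omega>)" for \<omega>
    proof -
      obtain c where c: "c \<in> C" "mdist ?X (empirical_process P0 \<F> n (T \<omega>)) c < \<epsilon>"
        using \<open>\<not> ?far (T \<omega>)\<close> by (auto simp: not_le)
      \<comment> \<open>Membership in the space of bounded functions lets the supremum distance
        control every single value of the process.\<close>
      have Z: "empirical_process P0 \<F> n (T \<omega>) \<in> mspace ?X"
        using measurable_space[OF Obs \<open>\<omega> \<in> space M\<close>]
        by (intro empirical_process_in_l_infinity bdd) (simp add: T_def)
      have "\<bar>empirical_process P0 \<F> n (T \<omega>) f - c f\<bar> < \<epsilon>" if "f \<in> \<F>" for f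
        using l_infinity_dist[OF Z _ that, of c] c C(2) by auto
      then show ?thesis using c(1) unfolding T_def[abs_def] by blast
    qed
    then have "outer_measure_of M {\<omega>\<in>space M. \<not> (\<exists>c\<in>C. \<forall>f\<in>\<F>.
       \<bar>empirical_process P0 \<F> n (\<lambda>i. Obs i \<omega>) f - c f\<bar> < \<epsilon>)}
       \<le> outer_measure_of M {\<omega>\<in>space M. ?far (T \<omega>)}"
      by (intro outer_measure_of_mono) blast
    also have "\<dots> \<le> outer_measure_of ?N {y\<in>space ?N. ?far y}"
      using outer_measure_of_distr[OF T, of ?far] \<open>distr M ?N T = ?N\<close> by simp
    also have "\<dots> \<le> ennreal \<eta>" using elim by simp
    finally show ?case .
  qed
  with C(1) show thesis by (rule that)
qed

section \<open>Asymptotic equicontinuity at a random member of the class\<close>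

lemma outer_measure_of_Un_le:
  assumes "A \<subseteq> space M" "B \<subseteq> space M" "outer_measure_of M A \<le> ennreal a" "outer_measure_of M B \<le> ennreal b"
    "0 \<le> a" "0 \<le> b"
  shows "outer_measure_of M (A \<union> B) \<le> ennreal (a + b)"
  using outer_measure_of_Un[OF assms(1,2)] add_mono[OF assms(3,4)] assms(5,6)
  by (simp add: ennreal_plus[symmetric] del: ennreal_plus)

lemma outer_measure_of_UN:
  fixes c :: real
  assumes "finite I" "\<And>i. i \<in> I \<Longrightarrow> A i \<subseteq> space M" "\<And>i. i \<in> I \<Longrightarrow> outer_measure_of M (A i) \<le> ennreal c" "0 \<le> c"
  shows "outer_measure_of M (\<Union>i\<in>I. A i) \<le> ennreal (card I * c)"
  using assms(1-3)
proof (induction I)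
  case (insert i I)
  then have "outer_measure_of M (\<Union>j\<in>I. A j) \<le> ennreal (card I * c)" "(\<Union>j\<in>I. A j) \<subseteq> space M"
    by auto
  then have "outer_measure_of M (A i \<union> (\<Union>j\<in>I. A j)) \<le> ennreal (c + card I * c)"
    using assms(4) insert.prems by (intro outer_measure_of_Un_le) auto
  then show ?case
    using insert.hyps by (simp add: algebra_simps)
qed simp

lemma prob_tends_to_0_le:
  assumes "prob_tends_to_0 M E" "0 < e"
  shows "\<forall>\<^sub>F n in sequentially. outer_measure_of M {\<omega>\<in>space M. E n \<omega>} \<le> ennreal e"
  using order_tendstoD(2)[OF assms(1)[unfolded prob_tends_to_0_def], of "ennreal e"] assms(2)
  by (auto elim: eventually_mono)

text \<open>With probability tending to 1 the random function is in the class and close to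
  \<open>D0\<close>; one such sample point gives a fixed approximant of \<open>D0\<close> and shows
  that \<open>D0\<close> is square integrable.\<close>

lemma Donsker_approx:
  fixes Dn :: "nat \<Rightarrow> 'w \<Rightarrow> 'o \<Rightarrow> real"
  assumes "prob_space M" "Donsker_class P0 \<F>" "D0 \<in> borel_measurable P0"
    "converges_to_0_in_prob M (\<lambda>n \<omega>. \<integral>\<^sup>+z. ennreal ((Dn n \<omega> z - D0 z)\<^sup>2) \<partial>P0)"
    "with_prob_tending_to_1 M (\<lambda>n \<omega>. Dn n \<omega> \<in> \<F>)" "\<delta> > 0"
  obtains n \<omega> where "n \<ge> 1" "\<omega> \<in> space M" "Dn n \<omega> \<in> \<F>"
    "integrable P0 (\<lambda>z. (Dn n \<omega> z - D0 z)\<^sup>2)" "(\<integral>z. (Dn n \<omega> z - D0 z)\<^sup>2 \<partial>P0) \<le> \<delta>"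
    "integrable P0 (\<lambda>z. (D0 z)\<^sup>2)"
proof -
  have "prob_tends_to_0 M (\<lambda>n \<omega>. (\<integral>\<^sup>+z. ennreal ((Dn n \<omega> z - D0 z)\<^sup>2) \<partial>P0) > ennreal \<delta> \<or> Dn n \<omega> \<notin> \<F>)"
    using assms(4-6) unfolding converges_to_0_in_prob_def with_prob_tending_to_1_def
    by (intro prob_tends_to_0_disj) simp_all
  then obtain n \<omega> where "n \<ge> 1" "\<omega> \<in> space M"
    "\<not> ((\<integral>\<^sup>+z. ennreal ((Dn n \<omega> z - D0 z)\<^sup>2) \<partial>P0) > ennreal \<delta> \<or> Dn n \<omega> \<notin> \<F>)"
    by (rule prob_tends_to_0_exists[OF assms(1)])
  then have n: "n \<ge> 1" "\<omega> \<in> space M" "Dn n \<omega> \<in> \<F>"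
    and le: "(\<integral>\<^sup>+z. ennreal ((Dn n \<omega> z - D0 z)\<^sup>2) \<partial>P0) \<le> ennreal \<delta>"
    by (simp_all add: not_less)
  have "Dn n \<omega> \<in> borel_measurable P0" "integrable P0 (\<lambda>z. (Dn n \<omega> z)\<^sup>2)"
    using assms(2) n(3) by (auto simp: Donsker_class_def)
  from L2_close[OF this(1) assms(3) this(2) le] assms(6) n show thesis
    by (intro that) auto
qed

text \<open>The limit \<open>D0\<close> is not assumed to lie in the class, so a fixed nearby member
  \<open>f\<close> serves as centre: the net compares \<open>Dn\<close> with \<open>f\<close>, and
  Chebyshev's inequality compares \<open>f\<close> with \<open>D0\<close>.\<close>

lemma Donsker_random_index:
  fixes Dn :: "nat \<Rightarrow> 'w \<Rightarrow> 'o \<Rightarrow> real" and Obs :: "nat \<Rightarrow> 'w \<Rightarrow> 'o"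
  assumes M: "prob_space M" "prob_space P0" "prob_space.indep_vars M (\<lambda>_. P0) Obs UNIV"
      "\<forall>i. distr M P0 (Obs i) = P0"
    and \<F>: "Donsker_class P0 \<F>" and D0[measurable]: "D0 \<in> borel_measurable P0"
    and conv: "converges_to_0_in_prob M (\<lambda>n \<omega>. \<integral>\<^sup>+z. ennreal ((Dn n \<omega> z - D0 z)\<^sup>2) \<partial>P0)"
    and Dn: "with_prob_tending_to_1 M (\<lambda>n \<omega>. Dn n \<omega> \<in> \<F>)"
  shows "small_o_P M (\<lambda>n. 1 / sqrt (real n))
    (\<lambda>n \<omega>. (emp n (\<lambda>i. Obs i \<omega>) (Dn n \<omega>) - (\<integral>z. Dn n \<omega> z \<partial>P0))
      - (emp n (\<lambda>i. Obs i \<omega>) D0 - (\<integral>z. D0 z \<partial>P0)))"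
proof -
  interpret P: prob_space P0 by fact
  define G where "G n \<omega> f = sqrt (real n) * (emp n (\<lambda>i. Obs i \<omega>) f - (\<integral>z. f z \<partial>P0))" for n \<omega> f
  have G_diff: "G n \<omega> (\<lambda>z. f z - g z) = G n \<omega> f - G n \<omega> g"
    if "integrable P0 f" "integrable P0 g" for n \<omega> f g
    using that by (simp add: G_def emp_diff algebra_simps)
  have meas[measurable_dest]: "f \<in> borel_measurable P0" and sq: "integrable P0 (\<lambda>z. (f z)\<^sup>2)"
    and int: "integrable P0 f" if "f \<in> \<F>" for f
    using \<F> that P.square_integrable_imp_integrable[of f] by (auto simp: Donsker_class_def)
  have main: "\<forall>\<^sub>F n in sequentially.
      outer_measure_of M {\<omega>\<in>space M. \<bar>G n \<omega> (Dn n \<omega>) - G n \<omega> D0\<bar> > \<epsilon>} \<le> ennreal e"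
    if "\<epsilon> > 0" "e > 0" for \<epsilon> e :: real
  proof -
    \<comment> \<open>The final chain costs \<open>a + 3 * a + a + a\<close>: \<open>Dn\<close> to
      its net value, across the net function, back to \<open>f\<close>, and from \<open>f\<close> to
      \<open>D0\<close>.\<close>
    define a where "a = \<epsilon> / 6"
    have a: "a > 0" using that by (simp add: a_def)
    \<comment> \<open>Four exceptional events share \<open>e\<close>: \<open>Dn\<close> outside the
      class, \<open>Dn\<close> far from \<open>D0\<close>, the process far from the net, and all
      Chebyshev events together.\<close>
    have e4: "e / 4 > 0" using that by simp
    obtain C :: "(('o \<Rightarrow> real) \<Rightarrow> real) set" where C: "finite C"
      and net: "\<forall>\<^sub>F n in sequentially. outer_measure_of M {\<omega>\<in>space M. \<not> (\<exists>c\<in>C. \<forall>f\<in>\<F>.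
        \<bar>empirical_process P0 \<F> n (\<lambda>i. Obs i \<omega>) f - c f\<bar> < a)} \<le> ennreal (e / 4)"
      by (rule Donsker_net[OF M(2) \<F> M(1,3,4) a e4])
    \<comment> \<open>At most \<open>card C\<close> oscillation events and the event
      \<open>W0\<close> each have probability at most \<open>4 * \<delta> / a\<^sup>2\<close>; this
      choice makes their total \<open>e / 4\<close>. It is possible because \<open>C\<close> is
      fixed before \<open>\<delta>\<close>.\<close>
    define \<delta> where "\<delta> = e * a\<^sup>2 / (16 * (card C + 1))"
    have "x * (4 * (e * b / (16 * x)) / b) = e / 4" if "x \<noteq> 0" "b \<noteq> 0" for x b :: real
      using that by (simp add: field_simps)
    from this[of "real (card C + 1)" "a\<^sup>2"] have \<delta>: "\<delta> > 0" "(card C + 1) * (4 * \<delta> / a\<^sup>2) = e / 4"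
      using \<open>e > 0\<close> a by (simp_all add: \<delta>_def)
    obtain f where f: "f \<in> \<F>" "integrable P0 (\<lambda>z. (f z - D0 z)\<^sup>2)" "(\<integral>z. (f z - D0 z)\<^sup>2 \<partial>P0) \<le> \<delta>"
      and sq0: "integrable P0 (\<lambda>z. (D0 z)\<^sup>2)"
      by (rule Donsker_approx[OF M(1) \<F> D0 conv Dn \<delta>(1)])
    have int0: "integrable P0 D0"
      by (rule P.square_integrable_imp_integrable[OF D0 sq0])
    note [measurable] = meas[OF f(1)]
    \<comment> \<open>Here \<open>g\<close> witnesses that the net function \<open>c\<close>
      oscillates by \<open>3 * a\<close> near \<open>f\<close>.\<close>
    define bad where "bad c g \<longleftrightarrow> g \<in> \<F> \<and> (\<integral>z. (g z - f z)\<^sup>2 \<partial>P0) \<le> 4 * \<delta> \<and> \<bar>c g - c f\<bar> \<ge> 3 * a" for c g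
    define B where "B = {c\<in>C. \<exists>g. bad c g}"
    \<comment> \<open>The witness depends on \<open>c\<close> alone, not on the sample, so
      Chebyshev's inequality applies to the fixed function \<open>g c - f\<close>.\<close>
    define g where "g c = (SOME g. bad c g)" for c :: "('o \<Rightarrow> real) \<Rightarrow> real"
    have g: "bad c (g c)" if "c \<in> B" for c
      using that unfolding g_def B_def by (auto intro: someI[of "bad c"])
    have B: "finite B" "card B \<le> card C"
      using C by (auto simp: B_def intro: card_mono)
    define W where "W n c = {\<omega>\<in>space M. a \<le> \<bar>G n \<omega> (\<lambda>z. g c z - f z)\<bar>}" for n c
    define W0 where "W0 n = {\<omega>\<in>space M. a \<le> \<bar>G n \<omega> (\<lambda>z. f z - D0 z)\<bar>}" for n
    have cheb: "outer_measure_of M {\<omega>\<in>space M. a \<le> \<bar>G n \<omega> u\<bar>} \<le> ennreal (4 * \<delta> / a\<^sup>2)"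
      if "u \<in> borel_measurable P0" "integrable P0 (\<lambda>z. (u z)\<^sup>2)" "(\<integral>z. (u z)\<^sup>2 \<partial>P0) \<le> 4 * \<delta>" for n u
      using emp_Chebyshev[OF M that(1,2) a, of n] that(3) a
      by (simp add: G_def) (erule order_trans, intro ennreal_leI divide_right_mono, auto)
    have W0: "outer_measure_of M (W0 n) \<le> ennreal (4 * \<delta> / a\<^sup>2)" for n
      unfolding W0_def by (rule cheb) (use f \<delta> in auto)
    have W: "outer_measure_of M (W n c) \<le> ennreal (4 * \<delta> / a\<^sup>2)" if "c \<in> B" for n c
    proof -
      have gc: "g c \<in> \<F>" "(\<integral>z. (g c z - f z)\<^sup>2 \<partial>P0) \<le> 4 * \<delta>"
        using g[OF that] by (auto simp: bad_def)
      note [measurable] = meas[OF gc(1)]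
      show ?thesis
        unfolding W_def by (rule cheb) (use gc f(1) in \<open>auto intro: integrable_sq_diff sq meas\<close>)
    qed
    let ?E1 = "\<lambda>n \<omega>. Dn n \<omega> \<notin> \<F>"
    let ?E2 = "\<lambda>n \<omega>. (\<integral>\<^sup>+z. ennreal ((Dn n \<omega> z - D0 z)\<^sup>2) \<partial>P0) > ennreal \<delta>"
    let ?E3 = "\<lambda>n \<omega>. \<not> (\<exists>c\<in>C. \<forall>f\<in>\<F>. \<bar>empirical_process P0 \<F> n (\<lambda>i. Obs i \<omega>) f - c f\<bar> < a)"
    have "\<forall>\<^sub>F n in sequentially. outer_measure_of M {\<omega>\<in>space M. ?E1 n \<omega>} \<le> ennreal (e / 4)"
      using prob_tends_to_0_le[OF _ e4] Dn by (simp add: with_prob_tending_to_1_def)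
    moreover have "\<forall>\<^sub>F n in sequentially. outer_measure_of M {\<omega>\<in>space M. ?E2 n \<omega>} \<le> ennreal (e / 4)"
      using conv \<delta>(1) unfolding converges_to_0_in_prob_def by (intro prob_tends_to_0_le[OF _ e4]) simp
    ultimately show ?thesis
      using net
    proof eventually_elim
      case (elim n)
      let ?V1 = "{\<omega>\<in>space M. ?E1 n \<omega>}" and ?V2 = "{\<omega>\<in>space M. ?E2 n \<omega>}" and ?V3 = "{\<omega>\<in>space M. ?E3 n \<omega>}"
      have "\<bar>G n \<omega> (Dn n \<omega>) - G n \<omega> D0\<bar> \<le> \<epsilon>"
        if \<omega>: "\<omega> \<in> space M" "\<not> ?E1 n \<omega>" "\<not> ?E2 n \<omega>" "\<not> ?E3 n \<omega>" "\<omega> \<notin> (\<Union>c\<in>B. W n c)" "\<omega> \<notin> W0 n" for \<omega>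
      proof -
        let ?D = "Dn n \<omega>"
        have D: "?D \<in> \<F>" using \<omega> by simp
        obtain c where c: "c \<in> C" "\<And>f. f \<in> \<F> \<Longrightarrow> \<bar>empirical_process P0 \<F> n (\<lambda>i. Obs i \<omega>) f - c f\<bar> < a"
          using \<omega>(4) by blast
        have near: "\<bar>G n \<omega> h - c h\<bar> < a" if "h \<in> \<F>" for h
          using c(2)[OF that] that by (simp add: empirical_process_def G_def)
        have le: "(\<integral>\<^sup>+z. ennreal ((?D z - D0 z)\<^sup>2) \<partial>P0) \<le> ennreal \<delta>"
          using \<omega>(3) by simp
        have "integrable P0 (\<lambda>z. (?D z - f z)\<^sup>2)"
          using D f(1) by (intro integrable_sq_diff meas sq)
        \<comment> \<open>Both \<open>?D\<close> and \<open>f\<close> are within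
          \<open>\<delta>\<close> of \<open>D0\<close>, giving
          \<open>2 * \<delta> + 2 * \<delta>\<close>.\<close>
        from integral_sq_triangle[OF L2_close(2)[OF meas[OF D] D0 sq[OF D] le] f(2) this]
          L2_close(3)[OF meas[OF D] D0 sq[OF D] le] f(3) \<delta>(1)
        have "(\<integral>z. (?D z - f z)\<^sup>2 \<partial>P0) \<le> 4 * \<delta>" by simp
        \<comment> \<open>Otherwise \<open>c\<close> would change by less than
          \<open>a + a + a\<close> between \<open>g c\<close> and \<open>f\<close>: the process is
          within \<open>a\<close> of \<open>c\<close> at both and, outside \<open>W n c\<close>,
          moves by less than \<open>a\<close>.\<close>
        moreover have "c \<notin> B"
        proof
          assume "c \<in> B"
          with g have gc: "g c \<in> \<F>" "\<bar>c (g c) - c f\<bar> \<ge> 3 * a" by (auto simp: bad_def)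
          have "\<bar>G n \<omega> (g c) - G n \<omega> f\<bar> < a"
            using \<omega>(1,5) \<open>c \<in> B\<close> G_diff[OF int int, OF gc(1) f(1)] by (force simp: W_def)
          then show False using near[OF gc(1)] near[OF f(1)] gc(2) by linarith
        qed
        ultimately have "\<bar>c ?D - c f\<bar> < 3 * a"
          using D c(1) by (force simp: B_def bad_def)
        moreover have "\<bar>G n \<omega> f - G n \<omega> D0\<bar> < a"
          using \<omega>(1,6) G_diff[OF int[OF f(1)] int0] by (simp add: W0_def)
        ultimately show ?thesis
          using near[OF D] near[OF f(1)] unfolding a_def by linarith
      qed
      then have "{\<omega>\<in>space M. \<bar>G n \<omega> (Dn n \<omega>) - G n \<omega> D0\<bar> > \<epsilon>}
          \<subseteq> ?V1 \<union> (?V2 \<union> (?V3 \<union> ((\<Union>c\<in>B. W n c) \<union> W0 n)))"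
        by (simp add: subset_iff) (meson not_less)
      then have "outer_measure_of M {\<omega>\<in>space M. \<bar>G n \<omega> (Dn n \<omega>) - G n \<omega> D0\<bar> > \<epsilon>}
          \<le> outer_measure_of M (?V1 \<union> (?V2 \<union> (?V3 \<union> ((\<Union>c\<in>B. W n c) \<union> W0 n))))"
        by (rule outer_measure_of_mono)
      also have "\<dots> \<le> ennreal (e / 4 + (e / 4 + (e / 4 + (card B * (4 * \<delta> / a\<^sup>2) + 4 * \<delta> / a\<^sup>2))))"
        using elim e4 \<delta>(1)
        by (intro outer_measure_of_Un_le outer_measure_of_UN[OF B(1)] W W0) (auto simp: W_def W0_def)
      also have "\<dots> \<le> ennreal e"
      proof (rule ennreal_leI)
        have "card B * (4 * \<delta> / a\<^sup>2) \<le> card C * (4 * \<delta> / a\<^sup>2)"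
          using B(2) \<delta>(1) by (intro mult_right_mono) auto
        moreover have "card C * (4 * \<delta> / a\<^sup>2) + 4 * \<delta> / a\<^sup>2 = e / 4"
          using \<delta>(2) by (simp only: of_nat_add of_nat_1 distrib_right mult_1)
        ultimately show "e / 4 + (e / 4 + (e / 4 + (card B * (4 * \<delta> / a\<^sup>2) + 4 * \<delta> / a\<^sup>2))) \<le> e"
          by linarith
      qed
      finally show ?case .
    qed
  qed
  show ?thesis
    unfolding small_o_P_def
  proof (intro allI impI)
    fix \<epsilon> :: real assume "\<epsilon> > 0"
    then have "prob_tends_to_0 M (\<lambda>n \<omega>. \<bar>G n \<omega> (Dn n \<omega>) - G n \<omega> D0\<bar> > \<epsilon>)"
      by (intro prob_tends_to_0I main)
    then show "prob_tends_to_0 M (\<lambda>n \<omega>. \<bar>(emp n (\<lambda>i. Obs i \<omega>) (Dn n \<omega>) - (\<integral>z. Dn n \<omega> z \<partial>P0))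
      - (emp n (\<lambda>i. Obs i \<omega>) D0 - (\<integral>z. D0 z \<partial>P0))\<bar> > \<epsilon> * (1 / sqrt (real n)))"
    proof (rule prob_tends_to_0_mono)
      have "\<bar>G n \<omega> f - G n \<omega> h\<bar> = sqrt (real n) * \<bar>(emp n (\<lambda>i. Obs i \<omega>) f - (\<integral>z. f z \<partial>P0))
          - (emp n (\<lambda>i. Obs i \<omega>) h - (\<integral>z. h z \<partial>P0))\<bar>" for n \<omega> f h
        by (simp add: G_def abs_mult flip: right_diff_distrib)
      then show "\<forall>\<^sub>F n in sequentially. \<forall>\<omega>\<in>space M.
          \<bar>(emp n (\<lambda>i. Obs i \<omega>) (Dn n \<omega>) - (\<integral>z. Dn n \<omega> z \<partial>P0))
            - (emp n (\<lambda>i. Obs i \<omega>) D0 - (\<integral>z. D0 z \<partial>P0))\<bar> > \<epsilon> * (1 / sqrt (real n)) \<longrightarrow>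
          \<bar>G n \<omega> (Dn n \<omega>) - G n \<omega> D0\<bar> > \<epsilon>"
        by (intro eventually_mono[OF eventually_gt_at_top[of 0]]) (simp add: field_simps)
    qed
  qed
qed

text \<open>The squared mean of \<open>D0\<close> equals that of \<open>Dn - D0\<close>, which the
  mean square distance bounds by an arbitrary \<open>\<delta>\<close>.\<close>

lemma limit_mean_eq_0:
  fixes Dn :: "nat \<Rightarrow> 'w \<Rightarrow> 'o \<Rightarrow> real"
  assumes "prob_space M" "prob_space P0" "Donsker_class P0 \<F>" "D0 \<in> borel_measurable P0"
    "converges_to_0_in_prob M (\<lambda>n \<omega>. \<integral>\<^sup>+z. ennreal ((Dn n \<omega> z - D0 z)\<^sup>2) \<partial>P0)"
    "with_prob_tending_to_1 M (\<lambda>n \<omega>. Dn n \<omega> \<in> \<F>)"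
    and mean: "\<And>n \<omega>. n \<ge> 1 \<Longrightarrow> \<omega> \<in> space M \<Longrightarrow> (\<integral>z. Dn n \<omega> z \<partial>P0) = 0"
  shows "(\<integral>z. D0 z \<partial>P0) = 0"
proof -
  interpret P: prob_space P0 by fact
  have "(\<integral>z. D0 z \<partial>P0)\<^sup>2 \<le> \<delta>" if \<delta>: "\<delta> > 0" for \<delta>
  proof -
    obtain n \<omega> where n: "n \<ge> 1" "\<omega> \<in> space M" "Dn n \<omega> \<in> \<F>"
      and sq: "integrable P0 (\<lambda>z. (Dn n \<omega> z - D0 z)\<^sup>2)" "(\<integral>z. (Dn n \<omega> z - D0 z)\<^sup>2 \<partial>P0) \<le> \<delta>"
        "integrable P0 (\<lambda>z. (D0 z)\<^sup>2)"
      by (rule Donsker_approx[OF assms(1,3-6) \<delta>])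
    have [measurable]: "Dn n \<omega> \<in> borel_measurable P0" "D0 \<in> borel_measurable P0"
      and sqn: "integrable P0 (\<lambda>z. (Dn n \<omega> z)\<^sup>2)"
      using assms(3,4) n(3) by (auto simp: Donsker_class_def)
    have int: "integrable P0 (Dn n \<omega>)" "integrable P0 D0" "integrable P0 (\<lambda>z. Dn n \<omega> z - D0 z)"
      using sq sqn by (auto intro!: P.square_integrable_imp_integrable)
    have "(\<integral>z. D0 z \<partial>P0)\<^sup>2 = (\<integral>z. Dn n \<omega> z - D0 z \<partial>P0)\<^sup>2"
      using int mean[OF n(1,2)] by simp
    \<comment> \<open>The Cauchy-Schwarz inequality against the constant 1, in the form of
      nonnegativity of the variance.\<close>
    also have "\<dots> \<le> (\<integral>z. (Dn n \<omega> z - D0 z)\<^sup>2 \<partial>P0)"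
      using P.variance_eq[OF int(3) sq(1)] P.variance_positive[of "\<lambda>z. Dn n \<omega> z - D0 z"] by linarith
    finally show ?thesis using sq(2) by linarith
  qed
  then have "(\<integral>z. D0 z \<partial>P0)\<^sup>2 \<le> 0"
    by (rule field_le_epsilon[of _ 0, simplified])
  then show ?thesis by simp
qed

section \<open>Expansion of the plug-in estimator and its asymptotic linearity\<close>

theorem theorem13:
  fixes M :: "'w measure" and P0 :: "'o measure" and Obs :: "nat \<Rightarrow> 'w \<Rightarrow> 'o"
    and k :: nat
    and L :: "(real^'d::finite \<Rightarrow> real) \<Rightarrow> 'o \<Rightarrow> real"
    and \<Q> :: "(real^'d \<Rightarrow> real) set" and Q0 :: "real^'d \<Rightarrow> real"
    and Pn :: "nat \<Rightarrow> 'w \<Rightarrow> ('o \<Rightarrow> real) \<Rightarrow> real"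
    and \<beta> :: "nat \<Rightarrow> 'w \<Rightarrow> 'd spline_index \<Rightarrow> real"
    and Rn R0n :: "nat \<Rightarrow> 'w \<Rightarrow> 'd spline_index set"
    and V :: "nat \<Rightarrow> 'w \<Rightarrow> (real^'d \<Rightarrow> real) set"
    and Qn Q0n :: "nat \<Rightarrow> 'w \<Rightarrow> real^'d \<Rightarrow> real"
    and J :: information
    and ip :: "nat \<Rightarrow> 'w \<Rightarrow> (real^'d \<Rightarrow> real) \<Rightarrow> (real^'d \<Rightarrow> real) \<Rightarrow> real"
    and \<phi> :: "nat \<Rightarrow> 'w \<Rightarrow> 'd spline_index \<Rightarrow> real^'d \<Rightarrow> real"
    and \<Phi> :: "(real^'d \<Rightarrow> real) \<Rightarrow> real"
    and D :: "nat \<Rightarrow> 'w \<Rightarrow> real^'d \<Rightarrow> 'o \<Rightarrow> real"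
    and Rem :: "nat \<Rightarrow> 'w \<Rightarrow> real^'d \<Rightarrow> real"
    and D\<Phi> :: "nat \<Rightarrow> 'w \<Rightarrow> 'o \<Rightarrow> real" and D\<Phi>0 :: "'o \<Rightarrow> real"
  assumes "prob_space M" and "prob_space P0"
    and iid: "prob_space.indep_vars M (\<lambda>_. P0) Obs UNIV" "\<forall>i. distr M P0 (Obs i) = P0"
    and Pn: "Pn = (\<lambda>n \<omega>. emp n (\<lambda>i. Obs i \<omega>))"
    and Q0: "risk_minimizer P0 L \<Q> Q0"
    and estimator:
      "(\<exists>\<R>. (\<forall>n. \<forall>R\<in>\<R> n. finite R \<and> R \<subseteq> spline_indices k) \<and>
          (\<forall>n\<ge>1. \<forall>\<omega>\<in>space M. sieve_MLE k (\<R> n) (\<lambda>Q. Pn n \<omega> (L Q)) (\<beta> n \<omega>)))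
       \<or> (\<exists>Rmax C. (\<forall>n \<omega>. finite (Rmax n \<omega>) \<and> Rmax n \<omega> \<subseteq> spline_indices k) \<and>
          (\<forall>n\<ge>1. \<forall>\<omega>\<in>space M.
             HAL_MLE k (Rmax n \<omega>) (C n \<omega>) (\<lambda>Q. Pn n \<omega> (L Q)) (\<beta> n \<omega>)))
       \<or> (\<exists>Rmax C. (\<forall>n \<omega>. finite (Rmax n \<omega>) \<and> Rmax n \<omega> \<subseteq> spline_indices k) \<and>
          (\<forall>n\<ge>1. \<forall>\<omega>\<in>space M.
             relax_HAL_MLE k (Rmax n \<omega>) (C n \<omega>) (\<lambda>Q. Pn n \<omega> (L Q)) (\<beta> n \<omega>)))"
    and Rn: "Rn = (\<lambda>n \<omega>. nonzero (\<beta> n \<omega>))"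
    and Qn: "Qn = (\<lambda>n \<omega>. spline k (Rn n \<omega>) (\<beta> n \<omega>))"
    and R0n: "R0n = Rn"
    and V: "V = (\<lambda>n \<omega>. spline_space k (R0n n \<omega>))"
    and Q0n: "\<forall>n\<ge>1. \<forall>\<omega>\<in>space M. risk_minimizer P0 L (V n \<omega>) (Q0n n \<omega>)"
    and scores: "\<forall>n\<ge>1. \<forall>\<omega>\<in>space M. \<forall>z\<in>space P0.
        differentiable_along (V n \<omega>) (\<lambda>Q. L Q z) (Q0n n \<omega>)"
      "\<forall>n\<ge>1. \<forall>\<omega>\<in>space M. \<forall>f\<in>V n \<omega>. risk_differentiable P0 L (Q0n n \<omega>) f"
    and ip: "ip = (\<lambda>n \<omega>. J_inner J P0 L (Q0n n \<omega>))"
      "\<forall>n\<ge>1. \<forall>\<omega>\<in>space M. inner_product_along (V n \<omega>) (ip n \<omega>)"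
    and orthonormal: "\<forall>n\<ge>1. \<forall>\<omega>\<in>space M.
        orthonormal_basis_along (V n \<omega>) (ip n \<omega>) (R0n n \<omega>) (\<phi> n \<omega>)"
    and D: "D = (\<lambda>n \<omega>. D_expansion L (Q0n n \<omega>) (R0n n \<omega>) (\<phi> n \<omega>))"
    and Rem: "Rem = (\<lambda>n \<omega>.
        R_expansion J (Pn n \<omega>) P0 L (Qn n \<omega>) (Q0n n \<omega>) (R0n n \<omega>) (\<phi> n \<omega>))"
    and \<Phi>: "\<forall>n\<ge>1. \<forall>\<omega>\<in>space M. differentiable_along (V n \<omega>) \<Phi> (Q0n n \<omega>)"
    and D\<Phi>: "D\<Phi> = (\<lambda>n \<omega>. D_functional \<Phi> L (Q0n n \<omega>) (R0n n \<omega>) (\<phi> n \<omega>))"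
  shows
    "(\<forall>n\<ge>1. \<forall>\<omega>\<in>space M.
        (\<forall>x. Qn n \<omega> x - Q0n n \<omega> x = Pn n \<omega> (D n \<omega> x) + Rem n \<omega> x) \<and>
        \<Phi> (Qn n \<omega>) - \<Phi> (Q0n n \<omega>) = Pn n \<omega> (D\<Phi> n \<omega>)
          + dirderiv \<Phi> (Q0n n \<omega>) (Rem n \<omega>) + functional_rem \<Phi> (Qn n \<omega>) (Q0n n \<omega>) \<and>
        (\<exists>!G. canonical_gradient (V n \<omega>) (ip n \<omega>) (dirderiv \<Phi> (Q0n n \<omega>)) G) \<and>
        (\<forall>G. canonical_gradient (V n \<omega>) (ip n \<omega>) (dirderiv \<Phi> (Q0n n \<omega>)) G \<longrightarrow>
           (\<forall>z\<in>space P0. D\<Phi> n \<omega> z = score L (Q0n n \<omega>) G z)))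
     \<and> (small_o_P M (\<lambda>n. 1 / sqrt (real n)) (\<lambda>n \<omega>. dirderiv \<Phi> (Q0n n \<omega>) (Rem n \<omega>)) \<and>
        small_o_P M (\<lambda>n. 1 / sqrt (real n)) (\<lambda>n \<omega>. functional_rem \<Phi> (Qn n \<omega>) (Q0n n \<omega>)) \<and>
        D\<Phi>0 \<in> borel_measurable P0 \<and>
        converges_to_0_in_prob M (\<lambda>n \<omega>. \<integral>\<^sup>+z. ennreal ((D\<Phi> n \<omega> z - D\<Phi>0 z)\<^sup>2) \<partial>P0) \<and>
        (\<exists>\<F>. Donsker_class P0 \<F> \<and> with_prob_tending_to_1 M (\<lambda>n \<omega>. D\<Phi> n \<omega> \<in> \<F>))
        \<longrightarrow>
        small_o_P M (\<lambda>n. 1 / sqrt (real n))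
          (\<lambda>n \<omega>. \<Phi> (Qn n \<omega>) - \<Phi> (Q0n n \<omega>) - Pn n \<omega> D\<Phi>0) \<and>
        (small_o_P M (\<lambda>n. 1 / sqrt (real n)) (\<lambda>n \<omega>. \<Phi> (Q0n n \<omega>) - \<Phi> Q0) \<longrightarrow>
           asymptotically_linear M Obs (\<lambda>n \<omega>. \<Phi> (Qn n \<omega>)) (\<Phi> Q0) D\<Phi>0))"
proof -
  have finite: "finite (R0n n \<omega>)" if "n \<ge> 1" "\<omega> \<in> space M" for n \<omega>
    using estimator
  proof (elim disjE exE conjE)
    fix \<R> assume "\<forall>n. \<forall>R\<in>\<R> n. finite R \<and> R \<subseteq> spline_indices k"
      "\<forall>n\<ge>1. \<forall>\<omega>\<in>space M. sieve_MLE k (\<R> n) (\<lambda>Q. Pn n \<omega> (L Q)) (\<beta> n \<omega>)"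
    then show ?thesis
      unfolding R0n Rn using that
      by (intro finite_nonzero_estimator[where \<R> = "\<R> n" and k = k and risk = "\<lambda>Q. Pn n \<omega> (L Q)"]) simp
  next
    fix Rmax C assume "\<forall>n \<omega>. finite (Rmax n \<omega>) \<and> Rmax n \<omega> \<subseteq> spline_indices k"
      "\<forall>n\<ge>1. \<forall>\<omega>\<in>space M. HAL_MLE k (Rmax n \<omega>) (C n \<omega>) (\<lambda>Q. Pn n \<omega> (L Q)) (\<beta> n \<omega>)"
    then show ?thesis
      unfolding R0n Rn using that
      by (intro finite_nonzero_estimator[where Rmax = "Rmax n \<omega>" and k = k and
          risk = "\<lambda>Q. Pn n \<omega> (L Q)" and C = "C n \<omega>"]) simp
  next
    fix Rmax C assume "\<forall>n \<omega>. finite (Rmax n \<omega>) \<and> Rmax n \<omega> \<subseteq> spline_indices k"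
      "\<forall>n\<ge>1. \<forall>\<omega>\<in>space M. relax_HAL_MLE k (Rmax n \<omega>) (C n \<omega>) (\<lambda>Q. Pn n \<omega> (L Q)) (\<beta> n \<omega>)"
    then show ?thesis
      unfolding R0n Rn using that
      by (intro finite_nonzero_estimator[where Rmax = "Rmax n \<omega>" and k = k and
          risk = "\<lambda>Q. Pn n \<omega> (L Q)" and C = "C n \<omega>"]) simp
  qed
  have lin: "lin_closed (V n \<omega>)" for n \<omega>
    unfolding V by (rule lin_closed_spline_space)
  \<comment> \<open>The choice \<open>R0n = Rn\<close> puts the estimator in the very space over
    which the oracle minimizes.\<close>
  have Qn_in: "Qn n \<omega> \<in> V n \<omega>" for n \<omega>
    unfolding Qn V R0n by (simp add: spline_space_def)
  have Q0n_in: "Q0n n \<omega> \<in> V n \<omega>" if "n \<ge> 1" "\<omega> \<in> space M" for n \<omega>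
    using Q0n that by (auto simp: risk_minimizer_def is_arg_min_def)
  have ip': "inner_product_along (V n \<omega>) (J_inner J P0 L (Q0n n \<omega>))"
    and onb: "orthonormal_basis_along (V n \<omega>) (J_inner J P0 L (Q0n n \<omega>)) (R0n n \<omega>) (\<phi> n \<omega>)"
    and d\<Phi>: "linear_along (V n \<omega>) (dirderiv \<Phi> (Q0n n \<omega>))"
    if "n \<ge> 1" "\<omega> \<in> space M" for n \<omega>
    using ip orthonormal \<Phi> that by (simp_all add: differentiable_along_def)
  have expansion: "Qn n \<omega> x - Q0n n \<omega> x = Pn n \<omega> (D n \<omega> x) + Rem n \<omega> x"
    if "n \<ge> 1" "\<omega> \<in> space M" for n \<omega> x
    unfolding Pn D Rem
    by (rule estimator_expansion[OF lin ip' onb finite Qn_in Q0n_in]) (use that in auto)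
  have \<Phi>_expansion: "\<Phi> (Qn n \<omega>) - \<Phi> (Q0n n \<omega>) = Pn n \<omega> (D\<Phi> n \<omega>)
      + dirderiv \<Phi> (Q0n n \<omega>) (Rem n \<omega>) + functional_rem \<Phi> (Qn n \<omega>) (Q0n n \<omega>)"
    if "n \<ge> 1" "\<omega> \<in> space M" for n \<omega>
    unfolding Pn D\<Phi> Rem
    by (rule functional_expansion[OF lin ip' onb finite Qn_in Q0n_in d\<Phi>]) (use that in auto)
  define gradient where
    "gradient n \<omega> = canonical_gradient (V n \<omega>) (ip n \<omega>) (dirderiv \<Phi> (Q0n n \<omega>))" for n \<omega>
  have gradient_ex: "gradient n \<omega> (\<lambda>x. \<Sum>j\<in>R0n n \<omega>. dirderiv \<Phi> (Q0n n \<omega>) (\<phi> n \<omega> j) * \<phi> n \<omega> j x)"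
    if "n \<ge> 1" "\<omega> \<in> space M" for n \<omega>
    unfolding gradient_def ip(1)
    by (rule canonical_gradient_exists[OF lin ip' onb finite d\<Phi>]) (use that in auto)
  have gradient_unique: "G = H" if "n \<ge> 1" "\<omega> \<in> space M" "gradient n \<omega> G" "gradient n \<omega> H" for n \<omega> G H
    using canonical_gradient_unique[OF lin ip'[OF that(1,2)]] that(3,4)
    unfolding gradient_def ip(1) by blast
  have D\<Phi>_score: "D\<Phi> n \<omega> z = score L (Q0n n \<omega>) G z"
    if "n \<ge> 1" "\<omega> \<in> space M" "gradient n \<omega> G" "z \<in> space P0" for n \<omega> G z
    unfolding D\<Phi>
    by (rule D_functional_eq_score[OF lin ip' onb finite d\<Phi>])
      (use that scores(1) in \<open>auto simp: gradient_def ip(1)\<close>)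
  \<comment> \<open>The gradient is itself a direction in \<open>V n \<omega>\<close>, so the first
    order condition of the oracle applies to its score.\<close>
  have mean: "(\<integral>z. D\<Phi> n \<omega> z \<partial>P0) = 0" if n: "n \<ge> 1" "\<omega> \<in> space M" for n \<omega>
  proof -
    obtain G where G: "gradient n \<omega> G" using gradient_ex[OF n] ..
    then have "G \<in> V n \<omega>" by (simp add: gradient_def canonical_gradient_def)
    then have "(\<integral>z. score L (Q0n n \<omega>) G z \<partial>P0) = 0"
      using Q0n scores(2) n by (intro integral_score_eq_0[OF lin]) auto
    moreover have "(\<integral>z. D\<Phi> n \<omega> z \<partial>P0) = (\<integral>z. score L (Q0n n \<omega>) G z \<partial>P0)"
      \<comment> \<open>The score identity holds on \<open>space P0\<close>, which suffices for
        equality of the integrals.\<close>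
      by (rule Bochner_Integration.integral_cong) (simp_all add: D\<Phi>_score[OF n G])
    ultimately show ?thesis by simp
  qed
  have part1: "(\<forall>x. Qn n \<omega> x - Q0n n \<omega> x = Pn n \<omega> (D n \<omega> x) + Rem n \<omega> x) \<and>
      \<Phi> (Qn n \<omega>) - \<Phi> (Q0n n \<omega>) = Pn n \<omega> (D\<Phi> n \<omega>)
        + dirderiv \<Phi> (Q0n n \<omega>) (Rem n \<omega>) + functional_rem \<Phi> (Qn n \<omega>) (Q0n n \<omega>) \<and>
      (\<exists>!G. gradient n \<omega> G) \<and>
      (\<forall>G. gradient n \<omega> G \<longrightarrow> (\<forall>z\<in>space P0. D\<Phi> n \<omega> z = score L (Q0n n \<omega>) G z))"
    if n: "n \<ge> 1" "\<omega> \<in> space M" for n \<omega>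
  proof (intro conjI)
    show "\<exists>!G. gradient n \<omega> G"
    proof -
      obtain G where G: "gradient n \<omega> G" using gradient_ex[OF n] ..
      then show ?thesis by (intro ex1I[of "gradient n \<omega>" G] gradient_unique[OF n _ G])
    qed
  qed (use expansion[OF n] \<Phi>_expansion[OF n] D\<Phi>_score[OF n] in simp_all)
  let ?rate = "\<lambda>n. 1 / sqrt (real n)"
  have part2: "small_o_P M ?rate (\<lambda>n \<omega>. \<Phi> (Qn n \<omega>) - \<Phi> (Q0n n \<omega>) - Pn n \<omega> D\<Phi>0)"
    if rem: "small_o_P M ?rate (\<lambda>n \<omega>. dirderiv \<Phi> (Q0n n \<omega>) (Rem n \<omega>))"
      "small_o_P M ?rate (\<lambda>n \<omega>. functional_rem \<Phi> (Qn n \<omega>) (Q0n n \<omega>))"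
      and lim: "D\<Phi>0 \<in> borel_measurable P0"
      "converges_to_0_in_prob M (\<lambda>n \<omega>. \<integral>\<^sup>+z. ennreal ((D\<Phi> n \<omega> z - D\<Phi>0 z)\<^sup>2) \<partial>P0)"
      and \<F>: "Donsker_class P0 \<F>" "with_prob_tending_to_1 M (\<lambda>n \<omega>. D\<Phi> n \<omega> \<in> \<F>)" for \<F>
  proof -
    have mean0: "(\<integral>z. D\<Phi>0 z \<partial>P0) = 0"
      by (rule limit_mean_eq_0[OF assms(1,2) \<F>(1) lim \<F>(2) mean])
    show ?thesis
    \<comment> \<open>Both \<open>P0\<close>-means vanish, so replacing
      \<open>D\<Phi> n \<omega>\<close> by \<open>D\<Phi>0\<close> under \<open>Pn\<close> costs
      exactly the centred difference that equicontinuity makes negligible; the two remainders are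
      negligible by assumption.\<close>
    proof (rule small_o_P_cong)
      show "small_o_P M ?rate (\<lambda>n \<omega>. ((emp n (\<lambda>i. Obs i \<omega>) (D\<Phi> n \<omega>) - (\<integral>z. D\<Phi> n \<omega> z \<partial>P0))
          - (emp n (\<lambda>i. Obs i \<omega>) D\<Phi>0 - (\<integral>z. D\<Phi>0 z \<partial>P0)))
          + (dirderiv \<Phi> (Q0n n \<omega>) (Rem n \<omega>) + functional_rem \<Phi> (Qn n \<omega>) (Q0n n \<omega>)))"
        by (intro small_o_P_add rem Donsker_random_index[OF assms(1,2) iid \<F>(1) lim \<F>(2)])
    next
      fix n \<omega> assume n: "(n::nat) \<ge> 1" "\<omega> \<in> space M"
      show "((emp n (\<lambda>i. Obs i \<omega>) (D\<Phi> n \<omega>) - (\<integral>z. D\<Phi> n \<omega> z \<partial>P0))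
          - (emp n (\<lambda>i. Obs i \<omega>) D\<Phi>0 - (\<integral>z. D\<Phi>0 z \<partial>P0)))
          + (dirderiv \<Phi> (Q0n n \<omega>) (Rem n \<omega>) + functional_rem \<Phi> (Qn n \<omega>) (Q0n n \<omega>))
          = \<Phi> (Qn n \<omega>) - \<Phi> (Q0n n \<omega>) - Pn n \<omega> D\<Phi>0"
        unfolding \<Phi>_expansion[OF n] mean[OF n] mean0 by (simp add: Pn)
    qed
  qed
  have part3: "asymptotically_linear M Obs (\<lambda>n \<omega>. \<Phi> (Qn n \<omega>)) (\<Phi> Q0) D\<Phi>0"
    if "small_o_P M ?rate (\<lambda>n \<omega>. \<Phi> (Qn n \<omega>) - \<Phi> (Q0n n \<omega>) - Pn n \<omega> D\<Phi>0)"
      "small_o_P M ?rate (\<lambda>n \<omega>. \<Phi> (Q0n n \<omega>) - \<Phi> Q0)"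
    using small_o_P_add[OF that] unfolding asymptotically_linear_def
    by (rule small_o_P_cong) (simp add: Pn)
  show ?thesis
    unfolding gradient_def[symmetric] using part1 part2 part3 by blast
qed

end
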